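(* Consider the control-affine system $\dot{x}=f(x)+g(x)u$, $y=h(x)$ with state $x\in\mathbb{R}^n$, with controllability and observability energy functions $\mathcal{E}_c,\mathcal{E}_o$ as described in the context. Let $d\ge 2$ and let $v_i,w_i\in\mathbb{R}^{n^i}$, $i=2,\dots,d$, be the polynomial coefficients of these energy functions, i.e. to degree $d$, $$\mathcal{E}_c(x)=\tfrac12\sum_{i=2}^d v_i^\top x^{\otimes i}+O(\|x\|^{d+1}),\qquad \mathcal{E}_o(x)=\tfrac12\sum_{i=2}^d w_i^\top x^{\otimes i}+O(\|x\|^{d+1}),$$ where $\mathcal{E}_c$ solves the Hamilton-Jacobi equation $0=\frac{\partial \mathcal{E}_c}{\partial x}f+\frac12\frac{\partial \mathcal{E}_c}{\partial x}gg^\top\frac{\partial^\top \mathcal{E}_c}{\partial x}$, $\mathcal{E}_c(0)=0$, and $\mathcal{E}_o$ solves $0=\frac{\partial \mathcal{E}_o}{\partial x}f+\frac12h^\top h$, $\mathcal{E}_o(0)=0$. Let $V_2,W_2\in\mathbb{R}^{n\times n}$ be the symmetric matrices with $v_2=\mathrm{vec}(V_2)$, $w_2=\mathrm{vec}(W_2)$. Let $V_2=RR^\top$ and $W_2=LL^\top$ with square-root factors $R,L\in\mathbb{R}^{n\times n}$, and let $L^\top R^{-\top}=\mathcal{U}\Sigma\mathcal{V}^\top$ be a singular value decomposition. Define $T_1:=R^{-\top}\mathcal{V}$, and for each $k=3,\dots,d$ let $T_{k-1}\in\mathbb{R}^{n\times n^{k-1}}$ satisfy both the input-normal equations $$2N_k\left(I_{n^{k-1}}\otimes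 T_1^\top V_2\right)\mathrm{vec}(T_{k-1})=-N_k\Big(\sum_{\substack{i,j\ge2\\ i+j=k}}\mathrm{vec}(T_j^\top V_2T_i)+\sum_{i=3}^k\mathcal{T}_{i,k}^\top v_i\Big)$$ and the output-diagonal equations $$2\hat N_k\left(I_{n^{k-1}}\otimes T_1^\top W_2\right)\mathrm{vec}(T_{k-1})=-\hat N_k\Big(\sum_{\substack{i,j\ge2\\ i+j=k}}\mathrm{vec}(T_j^\top W_2T_i)+\sum_{i=3}^k\mathcal{T}_{i,k}^\top w_i\Big).$$ Then the polynomial transformation $$x=\Phi(z)=T_1z+T_2z^{\otimes2}+\dots+T_{d-1}z^{\otimes(d-1)}$$ is an input-normal/output-diagonal transformation to degree $d$.
   Context: System: $f:\mathbb{R}^n\to\mathbb{R}^n$, $g:\mathbb{R}^n\to\mathbb{R}^{n\times m}$, $h:\mathbb{R}^n\to\mathbb{R}^p$ are analytic with $f(0)=0$, $h(0)=0$, and the Jacobian linearization at the origin is minimal and asymptotically stable. The energy functions are $\mathcal{E}_c(x_0)=\min\frac12\int_{-\infty}^0\|u(t)\|^2dt$ over $u\in L_2(-\infty,0)$ with $x(-\infty)=0$, $x(0)=x_0$, and $\mathcal{E}_o(x_0)=\frac12\int_0^\infty\|y(t)\|^2dt$ with $x(0)=x_0$, $u\equiv0$. They are assumed to exist (be finite) and be smooth, and $0$ is assumed to be an asymptotically stable equilibrium of the vector field $-\big(f+gg^\top\frac{\partial^\top\mathcal{E}_c}{\partial x}\big)$. In particular $V_2,W_2$ are positive definite and $R,L$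 are invertible. Notation: $\otimes$ is the Kronecker product, and $x^{\otimes k}=x\otimes\dots\otimes x\in\mathbb{R}^{n^k}$ ($k$ factors). $\mathrm{vec}$ stacks the columns of a matrix. For matrices $T_i\in\mathbb{R}^{n\times n^i}$, $$\mathcal{T}_{m,l}:=\sum_{i_1+\dots+i_m=l}T_{i_1}\otimes\dots\otimes T_{i_m}\in\mathbb{R}^{n^m\times n^l},$$ the sum being over all ordered tuples of positive integers with sum $l$. The matrix $N_k$ is the binary $\binom{n+k-1}{k}\times n^k$ matrix whose rows are indexed by the distinct degree-$k$ monomials in $x_1,\dots,x_n$, with entry $1$ in row $\mu$ and column $j$ exactly when the $j$th entry of $x^{\otimes k}$ equals the monomial $\mu$. Equivalently $w^\top x^{\otimes k}=(N_kw)^\top x^{[k]}$ for all $w\in\mathbb{R}^{n^k}$, where $x^{[k]}$ is the vector of distinct degree-$k$ monomials. The rows are ordered so that the first $n$ correspond to the univariate (diagonal) monomials $x_1^k,\dots,x_n^k$; $\hat N_k$ is the matrix of the remaining rows of $N_k$ (the off-diagonal monomials, containing at least two distinct variables). Input-normal/output-diagonal to degree $d$: a transformation $x=\Phi(z)$ is so called if, up to terms of degree greater than $d$ in $z$, $$\mathcal{E}_c(\Phi(z))=\tfrac12\sum_{i=1}^nz_i^2,\qquad \mathcal{E}_o(\Phi(z))=\tfrac12\sum_{i=1}^nz_i^2\,\sigma_i^2(z_i),$$ where each $\sigma_i^2(z_i)$ is a polynomial in the single variable $z_i$; that is, the degree-$\le d$ part of $\mathcal{E}_c\circ\Phi$ is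 $\frac12z^\top z$ and the degree-$\le d$ part of $\mathcal{E}_o\circ\Phi$ is a sum of univariate monomials. *)

theory Defs
  imports
    "HOL-Analysis.Analysis"
    "HOL-Library.Landau_Symbols"
    "HOL-Computational_Algebra.Polynomial"
    "Jordan_Normal_Form.Gauss_Jordan_Elimination"
begin

text \<open>
  The state space is \<open>real ^ 'n\<close>. Coefficients live in the spaces of dimension \<open>n ^ k\<close>
  for varying \<open>k\<close> and are therefore vectors and matrices of \<open>Jordan_Normal_Form\<close>, whose
  indices start at 0. The two clashing notations of that library are renamed.
\<close>

no_notation vec_index (infixl "$" 100)
no_notation scalar_prod (infix "\<bullet>" 70)
notation vec_index (infixl "$\<^sub>v" 100)
notation scalar_prod (infix "\<bullet>\<^sub>v" 70)

hide_const (open) Matrix.vec Matrix.mat Matrix.row Matrix.col Matrix.rows Matrix.cols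

section \<open>The system and its energy functions\<close>

definition real_analytic :: "(real ^ 'n \<Rightarrow> real) \<Rightarrow> bool" where
  "real_analytic \<phi> \<longleftrightarrow>
    (\<forall>a. \<exists>r>0. \<exists>c :: ('n \<Rightarrow> nat) \<Rightarrow> real. \<forall>x \<in> ball a r.
      ((\<lambda>\<alpha>. c \<alpha> * (\<Prod>i\<in>UNIV. (x $ i - a $ i) ^ \<alpha> i)) has_sum \<phi> x) UNIV)"

definition grad :: "(real ^ 'n \<Rightarrow> real) \<Rightarrow> real ^ 'n \<Rightarrow> real ^ 'n" where
  "grad \<phi> x = (\<chi> i. frechet_derivative \<phi> (at x) (axis i 1))"

primrec cont_diff :: "nat \<Rightarrow> (real ^ 'n \<Rightarrow> real) \<Rightarrow> bool" where
  "cont_diff 0 \<phi> \<longleftrightarrow> continuous_on UNIV \<phi>"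
| "cont_diff (Suc k) \<phi> \<longleftrightarrow>
     \<phi> differentiable_on UNIV \<and> (\<forall>i. cont_diff k (\<lambda>x. grad \<phi> x $ i))"

definition smooth :: "(real ^ 'n \<Rightarrow> real) \<Rightarrow> bool" where
  "smooth \<phi> \<longleftrightarrow> (\<forall>k. cont_diff k \<phi>)"

definition forward_solution :: "(real ^ 'n \<Rightarrow> real ^ 'n) \<Rightarrow> (real \<Rightarrow> real ^ 'n) \<Rightarrow> bool" where
  "forward_solution F x \<longleftrightarrow>
    (\<forall>t\<ge>0. (x has_vector_derivative F (x t)) (at t within {0..}))"

text \<open>Stability, attractivity, and existence of the forward solutions near the origin, so that
  the first two are not vacuous.\<close>

definition asymptotically_stable :: "(real ^ 'n \<Rightarrow> real ^ 'n) \<Rightarrow> bool" where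
  "asymptotically_stable F \<longleftrightarrow>
    F 0 = 0 \<and>
    (\<forall>\<epsilon>>0. \<exists>\<delta>>0. \<forall>x. forward_solution F x \<longrightarrow> norm (x 0) < \<delta> \<longrightarrow> (\<forall>t\<ge>0. norm (x t) < \<epsilon>)) \<and>
    (\<exists>\<delta>>0. \<forall>x. forward_solution F x \<longrightarrow> norm (x 0) < \<delta> \<longrightarrow> (x \<longlongrightarrow> 0) at_top) \<and>
    (\<exists>\<delta>>0. \<forall>x0. norm x0 < \<delta> \<longrightarrow> (\<exists>x. forward_solution F x \<and> x 0 = x0))"

text \<open>The columns of \<open>A ^ k B\<close>, respectively the rows of \<open>C A ^ k\<close>, for \<open>k < n\<close> span the state
  space (Kalman's rank conditions). Note that \<open>*\<close> on \<open>real ^ 'n ^ 'n\<close> is not the matrix product.\<close>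

definition controllable :: "real ^ 'n ^ 'n \<Rightarrow> real ^ 'm ^ 'n \<Rightarrow> bool" where
  "controllable A B \<longleftrightarrow> span (\<Union>k<CARD('n). columns (((**) A ^^ k) B)) = UNIV"

definition observable :: "real ^ 'n ^ 'n \<Rightarrow> real ^ 'n ^ 'p \<Rightarrow> bool" where
  "observable A C \<longleftrightarrow> span (\<Union>k<CARD('n). rows (((\<lambda>M. M ** A) ^^ k) C)) = UNIV"

definition minimal :: "real ^ 'n ^ 'n \<Rightarrow> real ^ 'm ^ 'n \<Rightarrow> real ^ 'n ^ 'p \<Rightarrow> bool" where
  "minimal A B C \<longleftrightarrow> controllable A B \<and> observable A C"

definition L2_on :: "real set \<Rightarrow> (real \<Rightarrow> real ^ 'm) \<Rightarrow> bool" where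
  "L2_on S u \<longleftrightarrow> u \<in> borel_measurable (lebesgue_on S) \<and>
    integrable (lebesgue_on S) (\<lambda>t. (norm (u t))\<^sup>2)"

text \<open>The input \<open>u\<close> steers the state from 0 at time \<open>-\<infinity>\<close> to \<open>x0\<close> at time 0. As \<open>u\<close> is merely
  square integrable, the differential equation is read in integrated form.\<close>

definition steers_from_rest ::
  "(real ^ 'n \<Rightarrow> real ^ 'n) \<Rightarrow> (real ^ 'n \<Rightarrow> real ^ 'm ^ 'n) \<Rightarrow> (real \<Rightarrow> real ^ 'm) \<Rightarrow> real ^ 'n \<Rightarrow> bool"
where
  "steers_from_rest f g u x0 \<longleftrightarrow>
    (\<exists>x. (x \<longlongrightarrow> 0) at_bot \<and> x 0 = x0 \<and>
      (\<forall>t\<le>0. ((\<lambda>s. f (x s) + g (x s) *v u s) has_integral (x 0 - x t)) {t..0}))"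

definition control_costs ::
  "(real ^ 'n \<Rightarrow> real ^ 'n) \<Rightarrow> (real ^ 'n \<Rightarrow> real ^ 'm ^ 'n) \<Rightarrow> real ^ 'n \<Rightarrow> real set" where
  "control_costs f g x0 =
    {1 / 2 * (LINT t|lebesgue_on {..0}. (norm (u t))\<^sup>2) |u. L2_on {..0} u \<and> steers_from_rest f g u x0}"

definition controllability_energy ::
  "(real ^ 'n \<Rightarrow> real ^ 'n) \<Rightarrow> (real ^ 'n \<Rightarrow> real ^ 'm ^ 'n) \<Rightarrow> (real ^ 'n \<Rightarrow> real) \<Rightarrow> bool" where
  "controllability_energy f g E \<longleftrightarrow>
    (\<forall>x0. E x0 \<in> control_costs f g x0 \<and> (\<forall>c \<in> control_costs f g x0. E x0 \<le> c))"

definition observability_energy ::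
  "(real ^ 'n \<Rightarrow> real ^ 'n) \<Rightarrow> (real ^ 'n \<Rightarrow> real ^ 'p) \<Rightarrow> (real ^ 'n \<Rightarrow> real) \<Rightarrow> bool" where
  "observability_energy f h E \<longleftrightarrow>
    (\<forall>x0. \<exists>x. forward_solution f x \<and> x 0 = x0 \<and> L2_on {0..} (\<lambda>t. h (x t)) \<and>
      E x0 = 1 / 2 * (LINT t|lebesgue_on {0..}. (norm (h (x t)))\<^sup>2))"

section \<open>Kronecker calculus\<close>

definition kron_mat :: "real mat \<Rightarrow> real mat \<Rightarrow> real mat" (infixr "\<otimes>\<^sub>K" 75) where
  "A \<otimes>\<^sub>K B = Matrix.mat (dim_row A * dim_row B) (dim_col A * dim_col B)
     (\<lambda>(i, j). A $$ (i div dim_row B, j div dim_col B) * B $$ (i mod dim_row B, j mod dim_col B))"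

definition kron_vec :: "real Matrix.vec \<Rightarrow> real Matrix.vec \<Rightarrow> real Matrix.vec" where
  "kron_vec x y = Matrix.vec (dim_vec x * dim_vec y)
     (\<lambda>i. x $\<^sub>v (i div dim_vec y) * y $\<^sub>v (i mod dim_vec y))"

primrec kron_power :: "real Matrix.vec \<Rightarrow> nat \<Rightarrow> real Matrix.vec" where
  "kron_power x 0 = Matrix.vec 1 (\<lambda>_. 1)"
| "kron_power x (Suc k) = kron_vec x (kron_power x k)"

text \<open>Stacking of the columns of a matrix.\<close>

definition vectorize :: "real mat \<Rightarrow> real Matrix.vec" where
  "vectorize A = Matrix.vec (dim_row A * dim_col A) (\<lambda>i. A $$ (i mod dim_row A, i div dim_row A))"

definition compositions :: "nat \<Rightarrow> nat \<Rightarrow> nat list set" where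
  "compositions m l = {is. length is = m \<and> (\<forall>i \<in> set is. 0 < i) \<and> sum_list is = l}"

definition kron_sum :: "nat \<Rightarrow> (nat \<Rightarrow> real mat) \<Rightarrow> nat \<Rightarrow> nat \<Rightarrow> real mat" where
  "kron_sum n T m l = Matrix.mat (n ^ m) (n ^ l)
     (\<lambda>ij. \<Sum>is \<in> compositions m l. foldr (\<lambda>i A. T i \<otimes>\<^sub>K A) is (1\<^sub>m 1) $$ ij)"

text \<open>A monomial in \<open>n\<close> variables is given by its list of exponents.\<close>

definition monomial :: "nat list \<Rightarrow> real Matrix.vec \<Rightarrow> real" where
  "monomial \<mu> x = (\<Prod>i<length \<mu>. (x $\<^sub>v i) ^ (\<mu> ! i))"

text \<open>An admissible row order: an enumeration of the degree-\<open>k\<close> monomials that starts with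
  the \<open>k\<close>-th powers of the \<open>n\<close> variables and is otherwise arbitrary.\<close>

definition monomial_order :: "nat \<Rightarrow> nat \<Rightarrow> nat list list \<Rightarrow> bool" where
  "monomial_order n k ms \<longleftrightarrow>
    distinct ms \<and> set ms = {\<mu>. length \<mu> = n \<and> sum_list \<mu> = k} \<and>
    (\<forall>i<n. ms ! i = (replicate n 0)[i := k])"

text \<open>The matrices \<open>N\<^sub>k\<close>, whose rows are labelled by \<open>ms\<close>, and \<open>\<hat>N\<^sub>k\<close>. Over the reals,
  equality of monomials is equality of functions.\<close>

definition N_mat :: "nat \<Rightarrow> nat \<Rightarrow> nat list list \<Rightarrow> real mat" where
  "N_mat n k ms = Matrix.mat (length ms) (n ^ k)
     (\<lambda>(r, j). if \<forall>x \<in> carrier_vec n. kron_power x k $\<^sub>v j = monomial (ms ! r) x then 1 else 0)"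

definition N_hat_mat :: "nat \<Rightarrow> nat \<Rightarrow> nat list list \<Rightarrow> real mat" where
  "N_hat_mat n k ms = Matrix.mat (length ms - n) (n ^ k) (\<lambda>(r, j). N_mat n k ms $$ (n + r, j))"

text \<open>The bracket on the right-hand sides of the equations for \<open>T (k - 1)\<close>, for the energy
  function with quadratic part \<open>M\<close> and higher coefficients \<open>c i\<close>.\<close>

definition lower_terms ::
  "nat \<Rightarrow> (nat \<Rightarrow> real mat) \<Rightarrow> real mat \<Rightarrow> (nat \<Rightarrow> real Matrix.vec) \<Rightarrow> nat \<Rightarrow> real Matrix.vec" where
  "lower_terms n T M c k =
     finsum_vec TYPE(real) (n ^ k) (\<lambda>(i, j). vectorize (transpose_mat (T j) * M * T i))
       {(i, j). 2 \<le> i \<and> 2 \<le> j \<and> i + j = k} +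
     finsum_vec TYPE(real) (n ^ k) (\<lambda>i. transpose_mat (kron_sum n T i k) *\<^sub>v c i) {3..k}"

definition is_svd :: "nat \<Rightarrow> real mat \<Rightarrow> real mat \<Rightarrow> real mat \<Rightarrow> real mat \<Rightarrow> bool" where
  "is_svd n A U S V \<longleftrightarrow>
    U \<in> carrier_mat n n \<and> S \<in> carrier_mat n n \<and> V \<in> carrier_mat n n \<and>
    transpose_mat U * U = 1\<^sub>m n \<and> transpose_mat V * V = 1\<^sub>m n \<and>
    diagonal_mat S \<and> (\<forall>i<n. 0 \<le> S $$ (i, i)) \<and>
    A = U * S * transpose_mat V"

section \<open>Coordinates and transformations\<close>

text \<open>\<open>idx\<close> numbers the coordinates of \<open>real ^ 'n\<close>.\<close>

definition coord_vec :: "('n \<Rightarrow> nat) \<Rightarrow> real ^ 'n \<Rightarrow> real Matrix.vec" where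
  "coord_vec idx x = Matrix.vec CARD('n) (\<lambda>a. x $ inv_into UNIV idx a)"

definition poly_transformation ::
  "('n \<Rightarrow> nat) \<Rightarrow> nat \<Rightarrow> (nat \<Rightarrow> real mat) \<Rightarrow> real ^ 'n \<Rightarrow> real ^ 'n" where
  "poly_transformation idx D T z =
     (\<chi> i. \<Sum>k=1..D. (T k *\<^sub>v kron_power (coord_vec idx z) k) $\<^sub>v idx i)"

text \<open>\<open>\<sigma>2 i\<close> is the polynomial written \<open>\<sigma>\<^sub>i\<^sup>2\<close>.\<close>

definition input_normal_output_diagonal ::
  "nat \<Rightarrow> (real ^ 'n \<Rightarrow> real) \<Rightarrow> (real ^ 'n \<Rightarrow> real) \<Rightarrow> (real ^ 'n \<Rightarrow> real ^ 'n) \<Rightarrow> bool" where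
  "input_normal_output_diagonal d Ec Eo \<Phi> \<longleftrightarrow>
    (\<lambda>z. Ec (\<Phi> z) - 1 / 2 * (\<Sum>i\<in>UNIV. (z $ i)\<^sup>2)) \<in> O[at 0](\<lambda>z. norm z ^ (d + 1)) \<and>
    (\<exists>\<sigma>2 :: 'n \<Rightarrow> real poly.
      (\<lambda>z. Eo (\<Phi> z) - 1 / 2 * (\<Sum>i\<in>UNIV. (z $ i)\<^sup>2 * poly (\<sigma>2 i) (z $ i)))
        \<in> O[at 0](\<lambda>z. norm z ^ (d + 1)))"

end

theory Submission
  imports Defs
begin

text \<open>
  Substituting \<open>x = \<Phi>(z)\<close> into the Taylor polynomials and using the mixed product rule
  \<open>(A \<otimes> B) (x \<otimes> y) = A x \<otimes> B y\<close>, the part of degree \<open>k\<close> of twice an energy function is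
  \<open>\<Sum>\<^sub>i c\<^sub>i \<bullet> \<T>\<^sub>i\<^sub>,\<^sub>k z\<^sup>k\<close>. In the quadratic term \<open>i = 2\<close> the matrix \<open>T\<^sub>k\<^sub>-\<^sub>1\<close> occurs in exactly two
  summands, which agree by symmetry, so that for \<open>k \<ge> 3\<close> this part is \<open>q \<bullet> z\<^sup>k\<close> with \<open>q\<close> the
  difference of the two sides of the \<open>k\<close>-th equation before multiplication by \<open>N\<^sub>k\<close>. Multiplying by \<open>N\<^sub>k\<close>
  collects the coefficients of equal monomials: \<open>N\<^sub>k q = 0\<close> makes the part vanish, and
  \<open>\<hat>N\<^sub>k q = 0\<close> leaves only the pure powers. In degree 2, \<open>R\<^sup>T T\<^sub>1 = \<V>\<close> and
  \<open>L\<^sup>T T\<^sub>1 = \<U> \<Sigma>\<close> turn the quadratic forms into \<open>z\<^sup>T z\<close> and \<open>z\<^sup>T \<Sigma>\<^sup>T \<Sigma> z\<close>.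
\<close>

section \<open>Kronecker products\<close>

text \<open>Division with remainder by \<open>b\<close> writes each index below \<open>a * b\<close>
  uniquely as \<open>p * b + q\<close>. Entries of Kronecker products are addressed by exactly these
  two digits, so sums over them become double sums.\<close>

lemma sum_lessThan_mult:
  fixes f :: "nat \<Rightarrow> 'a::comm_monoid_add"
  shows "(\<Sum>i<a * b. f i) = (\<Sum>p<a. \<Sum>q<b. f (p * b + q))"
proof -
  have "(\<Sum>i<a * b. f i) = (\<Sum>p<a. sum f {p * b..<p * b + b})"
    by (simp add: sum.nat_group)
  also have "\<dots> = (\<Sum>p<a. \<Sum>q<b. f (p * b + q))"
  proof (rule sum.cong[OF refl])
    fix p
    show "sum f {p * b..<p * b + b} = (\<Sum>q<b. f (p * b + q))"
      using sum.shift_bounds_nat_ivl[of f 0 "p * b" b] by (simp add: add.commute lessThan_atLeast0)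
  qed
  finally show ?thesis .
qed

lemma mult_add_less_mult:
  fixes p q a b :: nat
  assumes "p < a" "q < b"
  shows "p * b + q < a * b"
proof -
  have "p * b + q < Suc p * b" using assms by simp
  also have "\<dots> \<le> a * b" using assms by (intro mult_le_mono1) simp
  finally show ?thesis .
qed

lemma mult_add_div_mod [simp]:
  fixes p q b :: nat
  assumes "q < b"
  shows "(p * b + q) div b = p" "(p * b + q) mod b = q"
  using assms div_mult_self1[of b q p] mod_mult_self1[of q p b] by (auto simp: add.commute)

lemma scalar_prod_sum: "dim_vec y = n \<Longrightarrow> x \<bullet>\<^sub>v y = (\<Sum>i<n. x $\<^sub>v i * y $\<^sub>v i)"
  by (simp add: scalar_prod_def lessThan_atLeast0)

lemma mult_mat_vec_index: "i < dim_row A \<Longrightarrow> dim_col A = n \<Longrightarrow> dim_vec x = n \<Longrightarrow>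
    (A *\<^sub>v x) $\<^sub>v i = (\<Sum>j<n. A $$ (i, j) * x $\<^sub>v j)"
  by (simp add: scalar_prod_sum)

lemma dim_kron_vec [simp]: "dim_vec (kron_vec x y) = dim_vec x * dim_vec y"
  by (simp add: kron_vec_def)

lemma kron_vec_carrier:
  "x \<in> carrier_vec a \<Longrightarrow> y \<in> carrier_vec b \<Longrightarrow> kron_vec x y \<in> carrier_vec (a * b)"
  by (auto intro: carrier_vecI)

lemma kron_vec_one: "kron_vec (Matrix.vec (Suc 0) (\<lambda>_. 1)) x = x"
  by (rule eq_vecI) (auto simp: kron_vec_def)

text \<open>An index of a triple product is a three-digit number in mixed radix. Both bracketings
  read off the same digits, which the facts \<open>1\<close>, \<open>2\<close> and \<open>3\<close>
  check one by one.\<close>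

lemma kron_vec_assoc: "kron_vec (kron_vec x y) z = kron_vec x (kron_vec y z)"
proof (rule eq_vecI)
  fix i assume i: "i < dim_vec (kron_vec x (kron_vec y z))"
  let ?y = "dim_vec y" and ?z = "dim_vec z"
  have i': "i < dim_vec x * ?y * ?z" using i by (simp add: mult.assoc)
  then have pos: "0 < ?y" "0 < ?z" by (auto intro!: Nat.gr0I)
  have lt: "i div ?z < dim_vec x * ?y" using i' less_mult_imp_div_less by blast
  have m: "i mod (?y * ?z) < ?y * ?z" using pos by simp
  have 1: "i mod (?y * ?z) div ?z = i div ?z mod ?y"
    using mod_mult2_eq[of i ?z ?y] mult_add_div_mod(1)[of "i mod ?z" ?z "i div ?z mod ?y"] pos
    by (simp add: mult.commute)
  have 2: "i mod (?y * ?z) mod ?z = i mod ?z"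
    by (simp add: mod_mod_cancel)
  have 3: "i div ?z div ?y = i div (?y * ?z)" using div_mult2_eq[of i ?z ?y] by (simp add: mult.commute)
  show "kron_vec (kron_vec x y) z $\<^sub>v i = kron_vec x (kron_vec y z) $\<^sub>v i"
    using i' lt m by (simp add: kron_vec_def 1 2 3 mult.assoc)
qed (simp add: mult.assoc)

lemma dim_kron_power [simp]: "dim_vec (kron_power x k) = dim_vec x ^ k"
  by (induction k) auto

lemma kron_power_carrier: "x \<in> carrier_vec n \<Longrightarrow> kron_power x k \<in> carrier_vec (n ^ k)"
  by (auto intro!: carrier_vecI)

lemma kron_power_add: "kron_power x (i + j) = kron_vec (kron_power x i) (kron_power x j)"
  by (induction i) (auto simp: kron_vec_one kron_vec_assoc)

section \<open>Kronecker products of matrices and the mixed product rule\<close>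

lemma kron_mat_carrier:
  "A \<in> carrier_mat a b \<Longrightarrow> B \<in> carrier_mat c d \<Longrightarrow> A \<otimes>\<^sub>K B \<in> carrier_mat (a * c) (b * d)"
  by (auto simp: kron_mat_def)

lemma dim_kron_mat [simp]:
  "dim_row (A \<otimes>\<^sub>K B) = dim_row A * dim_row B" "dim_col (A \<otimes>\<^sub>K B) = dim_col A * dim_col B"
  by (auto simp: kron_mat_def)

text \<open>Splitting the column index into its two digits turns each entry into a double sum whose
  summand separates, hence into a product of two sums.\<close>

lemma kron_mat_mult_kron_vec:
  assumes "dim_vec x = dim_col A" "dim_vec y = dim_col B"
  shows "(A \<otimes>\<^sub>K B) *\<^sub>v kron_vec x y = kron_vec (A *\<^sub>v x) (B *\<^sub>v y)"
proof (rule eq_vecI)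
  fix i assume "i < dim_vec (kron_vec (A *\<^sub>v x) (B *\<^sub>v y))"
  then have i: "i < dim_row A * dim_row B" by simp
  then have B: "0 < dim_row B" by (auto intro!: Nat.gr0I)
  have lt: "i div dim_row B < dim_row A" "i mod dim_row B < dim_row B"
    using i B less_mult_imp_div_less by auto
  let ?p = "i div dim_row B" and ?q = "i mod dim_row B"
  have "((A \<otimes>\<^sub>K B) *\<^sub>v kron_vec x y) $\<^sub>v i =
      (\<Sum>j<dim_col A * dim_col B. (A \<otimes>\<^sub>K B) $$ (i, j) * kron_vec x y $\<^sub>v j)"
    using i assms by (subst mult_mat_vec_index) auto
  also have "\<dots> = (\<Sum>r<dim_col A. \<Sum>s<dim_col B.
      (A $$ (?p, r) * x $\<^sub>v r) * (B $$ (?q, s) * y $\<^sub>v s))"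
    unfolding sum_lessThan_mult
    using i assms
    by (intro sum.cong refl) (auto simp: kron_mat_def kron_vec_def mult_add_less_mult)
  also have "\<dots> = (A *\<^sub>v x) $\<^sub>v ?p * (B *\<^sub>v y) $\<^sub>v ?q"
    using lt assms by (subst (1 2) mult_mat_vec_index) (auto simp: sum_product)
  also have "\<dots> = kron_vec (A *\<^sub>v x) (B *\<^sub>v y) $\<^sub>v i"
    using i by (simp add: kron_vec_def)
  finally show "((A \<otimes>\<^sub>K B) *\<^sub>v kron_vec x y) $\<^sub>v i = kron_vec (A *\<^sub>v x) (B *\<^sub>v y) $\<^sub>v i" .
qed simp

section \<open>Vectorization and bilinear forms\<close>

lemma vectorize_carrier: "A \<in> carrier_mat a b \<Longrightarrow> vectorize A \<in> carrier_vec (a * b)"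
  by (auto simp: vectorize_def intro!: carrier_vecI)

lemma vectorize_index:
  assumes "A \<in> carrier_mat a b" "p < b" "q < a"
  shows "vectorize A $\<^sub>v (p * a + q) = A $$ (q, p)"
  using assms mult_add_less_mult[of p b q a] by (auto simp: vectorize_def mult.commute)

text \<open>Stacking columns puts the entry \<open>(q, p)\<close> at position
  \<open>p * a + q\<close>, so the column index belongs to the left factor \<open>x\<close> and the
  row index to \<open>y\<close>. This reads a coefficient vector of degree 2 as a bilinear
  form.\<close>

lemma vectorize_scalar_prod_kron:
  assumes A: "A \<in> carrier_mat a b" and x: "x \<in> carrier_vec b" and y: "y \<in> carrier_vec a"
  shows "vectorize A \<bullet>\<^sub>v kron_vec x y = y \<bullet>\<^sub>v (A *\<^sub>v x)"
proof -
  have "vectorize A \<bullet>\<^sub>v kron_vec x y =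
      (\<Sum>p<b. \<Sum>q<a. vectorize A $\<^sub>v (p * a + q) * kron_vec x y $\<^sub>v (p * a + q))"
    using x y by (subst scalar_prod_sum[where n = "b * a"]) (auto simp: sum_lessThan_mult)
  also have "\<dots> = (\<Sum>p<b. \<Sum>q<a. A $$ (q, p) * (x $\<^sub>v p * y $\<^sub>v q))"
    using x y A by (intro sum.cong refl) (auto simp: vectorize_index kron_vec_def mult_add_less_mult)
  also have "\<dots> = (\<Sum>q<a. \<Sum>p<b. A $$ (q, p) * (x $\<^sub>v p * y $\<^sub>v q))"
    by (rule sum.swap)
  also have "\<dots> = y \<bullet>\<^sub>v (A *\<^sub>v x)"
    using A x y
    by (subst scalar_prod_sum[where n = a])
       (auto simp: scalar_prod_sum[where n = b] sum_distrib_left mult_ac intro!: sum.cong)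
  finally show ?thesis .
qed

text \<open>The left factor is block diagonal with one copy of \<open>M\<close> for each column of
  \<open>A\<close>. This removes the Kronecker product from the unknown term of the equations for
  \<open>T (k - 1)\<close>.\<close>

lemma kron_id_mult_vectorize:
  assumes M: "M \<in> carrier_mat a b" and A: "A \<in> carrier_mat b c"
  shows "(1\<^sub>m c \<otimes>\<^sub>K M) *\<^sub>v vectorize A = vectorize (M * A)"
proof (rule eq_vecI)
  fix i assume "i < dim_vec (vectorize (M * A))"
  then have i: "i < c * a" using M A by (simp add: vectorize_def mult.commute)
  then have "0 < a" by (auto intro!: Nat.gr0I)
  then have lt: "i div a < c" "i mod a < a" using i less_mult_imp_div_less by auto
  have "((1\<^sub>m c \<otimes>\<^sub>K M) *\<^sub>v vectorize A) $\<^sub>v i =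
      (\<Sum>p<c. \<Sum>q<b. (1\<^sub>m c \<otimes>\<^sub>K M) $$ (i, p * b + q) * vectorize A $\<^sub>v (p * b + q))"
    using M A i vectorize_carrier[OF A]
    by (subst mult_mat_vec_index[where n = "c * b"]) (auto simp: sum_lessThan_mult mult.commute[of b])
  also have "\<dots> = (\<Sum>p<c. if i div a = p then \<Sum>q<b. M $$ (i mod a, q) * A $$ (q, p) else 0)"
    using M A i lt
    by (intro sum.cong refl) (auto simp: kron_mat_def vectorize_index mult_add_less_mult)
  also have "\<dots> = (\<Sum>q<b. M $$ (i mod a, q) * A $$ (q, i div a))"
    using lt by simp
  also have "\<dots> = vectorize (M * A) $\<^sub>v i"
    using M A i lt by (simp add: vectorize_def mult.commute scalar_prod_sum[where n = b])
  finally show "((1\<^sub>m c \<otimes>\<^sub>K M) *\<^sub>v vectorize A) $\<^sub>v i = vectorize (M * A) $\<^sub>v i" .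
next
  show "dim_vec ((1\<^sub>m c \<otimes>\<^sub>K M) *\<^sub>v vectorize A) = dim_vec (vectorize (M * A))"
    using M A by (simp add: vectorize_def)
qed

section \<open>Monomials\<close>

lemma monomial_increment:
  assumes "a < length \<mu>"
  shows "monomial (\<mu>[a := Suc (\<mu> ! a)]) x = x $\<^sub>v a * monomial \<mu> x"
proof -
  have "monomial (\<mu>[a := Suc (\<mu> ! a)]) x =
      (\<Prod>i<length \<mu>. (if i = a then x $\<^sub>v a else 1) * (x $\<^sub>v i) ^ (\<mu> ! i))"
    using assms by (auto simp: monomial_def nth_list_update intro!: prod.cong)
  also have "\<dots> = x $\<^sub>v a * monomial \<mu> x"
    using assms by (simp add: prod.distrib monomial_def)
  finally show ?thesis .
qed

text \<open>The base-\<open>n\<close> digits of \<open>j\<close> name the variables that are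
  multiplied. In the induction the leading digit \<open>j div n ^ k\<close> raises the exponent of
  one variable by 1.\<close>

lemma kron_power_entry_monomial:
  assumes "j < n ^ k"
  obtains \<mu> where "length \<mu> = n" "sum_list \<mu> = k"
    "\<And>x. x \<in> carrier_vec n \<Longrightarrow> kron_power x k $\<^sub>v j = monomial \<mu> x"
proof -
  have "\<exists>\<mu>. length \<mu> = n \<and> sum_list \<mu> = k \<and>
      (\<forall>x \<in> carrier_vec n. kron_power x k $\<^sub>v j = monomial \<mu> x)"
    using assms
  proof (induction k arbitrary: j)
    case 0
    then show ?case
      by (intro exI[of _ "replicate n 0"]) (auto simp: monomial_def)
  next
    case (Suc k)
    then have "0 < n ^ k" by (auto intro!: Nat.gr0I)
    then have a: "j div n ^ k < n" and b: "j mod n ^ k < n ^ k"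
      using Suc.prems by (auto simp: less_mult_imp_div_less)
    from Suc.IH[OF b] obtain \<mu> where \<mu>: "length \<mu> = n" "sum_list \<mu> = k"
      "\<And>x. x \<in> carrier_vec n \<Longrightarrow> kron_power x k $\<^sub>v (j mod n ^ k) = monomial \<mu> x" by auto
    have "sum_list (\<mu>[j div n ^ k := Suc (\<mu> ! (j div n ^ k))]) = Suc k"
      using a \<mu>(1,2) elem_le_sum_list[of "j div n ^ k" \<mu>] by (simp add: sum_list_update)
    then show ?case
      using a \<mu> Suc.prems
      by (intro exI[of _ "\<mu>[j div n ^ k := Suc (\<mu> ! (j div n ^ k))]"])
         (auto simp: monomial_increment kron_vec_def)
  qed
  then show ?thesis using that by blast
qed

text \<open>Evaluation at the point with coordinate 2 in place \<open>i\<close> and 1 elsewhere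
  gives 2 to the power of the \<open>i\<close>-th exponent, which determines that exponent.\<close>

lemma monomial_inj:
  assumes "length \<mu> = n" "length \<nu> = n" "\<And>x. x \<in> carrier_vec n \<Longrightarrow> monomial \<mu> x = monomial \<nu> x"
  shows "\<mu> = \<nu>"
proof (rule nth_equalityI)
  fix i assume "i < length \<mu>"
  then have i: "i < n" using assms by simp
  define x :: "real Matrix.vec" where "x = Matrix.vec n (\<lambda>j. if j = i then 2 else 1)"
  have "monomial \<rho> x = 2 ^ (\<rho> ! i)" if "length \<rho> = n" for \<rho>
  proof -
    have "monomial \<rho> x = (\<Prod>j<n. if j = i then 2 ^ (\<rho> ! i) else 1)"
      using that unfolding monomial_def by (intro prod.cong) (auto simp: x_def)
    then show ?thesis using i by simp
  qed
  with assms have "(2::real) ^ (\<mu> ! i) = 2 ^ (\<nu> ! i)" using assms(3)[of x] by (simp add: x_def)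
  then show "\<mu> ! i = \<nu> ! i" by simp
qed (use assms in simp)

text \<open>Every column of \<open>N_mat\<close> contains exactly one 1, in the row of the monomial
  to which that entry of the Kronecker power is equal. Hence the rows add up the coefficients of
  equal monomials.\<close>

lemma N_mat_mult_scalar_prod_monomials:
  assumes ms: "monomial_order n k ms" and c: "c \<in> carrier_vec (n ^ k)" and x: "x \<in> carrier_vec n"
  shows "(\<Sum>r<length ms. (N_mat n k ms *\<^sub>v c) $\<^sub>v r * monomial (ms ! r) x) = c \<bullet>\<^sub>v kron_power x k"
proof -
  let ?N = "N_mat n k ms"
  have column: "(\<Sum>r<length ms. ?N $$ (r, j) * monomial (ms ! r) x) = kron_power x k $\<^sub>v j"
    if j: "j < n ^ k" for j
  proof -
    obtain \<mu> where \<mu>: "length \<mu> = n" "sum_list \<mu> = k"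
        "\<And>x. x \<in> carrier_vec n \<Longrightarrow> kron_power x k $\<^sub>v j = monomial \<mu> x"
      using kron_power_entry_monomial[OF j] by blast
    with ms have "\<mu> \<in> set ms" by (auto simp: monomial_order_def)
    then obtain r0 where r0: "r0 < length ms" "ms ! r0 = \<mu>" by (auto simp: in_set_conv_nth)
    have "?N $$ (r, j) = (if r = r0 then 1 else 0)" if r: "r < length ms" for r
    proof -
      \<comment> \<open>Injectivity of monomials turns the equality of functions in the definition
        of \<open>N_mat\<close> into equality of exponent lists; distinctness of \<open>ms\<close>
        turns that into equality of rows.\<close>
      have "length (ms ! r) = n" using ms r nth_mem by (fastforce simp: monomial_order_def)
      then have "(\<forall>x \<in> carrier_vec n. monomial \<mu> x = monomial (ms ! r) x) \<longleftrightarrow> \<mu> = ms ! r"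
        using monomial_inj[of \<mu> n "ms ! r"] \<mu>(1) by blast
      also have "\<dots> \<longleftrightarrow> r = r0"
        using r r0 ms by (auto simp: monomial_order_def nth_eq_iff_index_eq)
      finally show ?thesis using r j \<mu>(3) by (simp add: N_mat_def)
    qed
    then have "(\<Sum>r<length ms. ?N $$ (r, j) * monomial (ms ! r) x) =
        (\<Sum>r<length ms. if r = r0 then monomial (ms ! r) x else 0)"
      by (intro sum.cong) auto
    then show ?thesis using r0 \<mu>(3) x by simp
  qed
  have N: "dim_row ?N = length ms" "dim_col ?N = n ^ k" by (auto simp: N_mat_def)
  have "(\<Sum>r<length ms. (?N *\<^sub>v c) $\<^sub>v r * monomial (ms ! r) x) =
      (\<Sum>r<length ms. \<Sum>j<n ^ k. c $\<^sub>v j * (?N $$ (r, j) * monomial (ms ! r) x))"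
    using c N by (intro sum.cong refl, subst mult_mat_vec_index)
      (auto simp: sum_distrib_left sum_distrib_right mult_ac intro!: sum.cong)
  also have "\<dots> = (\<Sum>j<n ^ k. c $\<^sub>v j * kron_power x k $\<^sub>v j)"
    by (subst sum.swap) (simp add: column flip: sum_distrib_left)
  also have "\<dots> = c \<bullet>\<^sub>v kron_power x k"
    using x by (simp add: scalar_prod_sum)
  finally show ?thesis .
qed

lemma monomial_univariate:
  assumes "a < n"
  shows "monomial ((replicate n 0)[a := k]) x = (x $\<^sub>v a) ^ k"
proof -
  have "monomial ((replicate n 0)[a := k]) x = (\<Prod>i<n. if i = a then (x $\<^sub>v a) ^ k else 1)"
    unfolding monomial_def by (intro prod.cong) (auto simp: nth_list_update)
  then show ?thesis using assms by simp
qed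

text \<open>The rows of \<open>N_hat_mat\<close> are those of \<open>N_mat\<close> from number
  \<open>n\<close> on. If they annihilate \<open>c\<close>, only the first \<open>n\<close>
  monomials survive, and these are the pure powers.\<close>

lemma N_hat_mat_zero_imp_univariate:
  assumes ms: "monomial_order n k ms" and c: "c \<in> carrier_vec (n ^ k)"
    and zero: "N_hat_mat n k ms *\<^sub>v c = 0\<^sub>v (length ms - n)"
  obtains b where "\<And>x. x \<in> carrier_vec n \<Longrightarrow> c \<bullet>\<^sub>v kron_power x k = (\<Sum>a<n. b a * (x $\<^sub>v a) ^ k)"
proof
  let ?N = "N_mat n k ms"
  \<comment> \<open>The default 0 covers lists shorter than \<open>n\<close>: for
    \<open>k = 0\<close> there is only one monomial.\<close>
  let ?b = "\<lambda>a. if a < length ms then (?N *\<^sub>v c) $\<^sub>v a else 0"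
  fix x :: "real Matrix.vec" assume x: "x \<in> carrier_vec n"
  have off_diagonal: "(?N *\<^sub>v c) $\<^sub>v r = 0" if "r < length ms" "\<not> r < n" for r
  proof -
    have "(?N *\<^sub>v c) $\<^sub>v r = (N_hat_mat n k ms *\<^sub>v c) $\<^sub>v (r - n)"
      using that c
      by (subst (1 2) mult_mat_vec_index[where n = "n ^ k"]) (auto simp: N_hat_mat_def N_mat_def)
    then show ?thesis using zero that by simp
  qed
  have "c \<bullet>\<^sub>v kron_power x k = (\<Sum>r<length ms. (?N *\<^sub>v c) $\<^sub>v r * monomial (ms ! r) x)"
    using N_mat_mult_scalar_prod_monomials[OF ms c x] by simp
  also have "\<dots> = (\<Sum>r\<in>{..<length ms} \<inter> {..<n}. ?b r * (x $\<^sub>v r) ^ k)"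
    using ms off_diagonal
    by (intro sum.mono_neutral_cong_right) (auto simp: monomial_order_def monomial_univariate)
  also have "\<dots> = (\<Sum>a<n. ?b a * (x $\<^sub>v a) ^ k)"
    by (intro sum.mono_neutral_left) auto
  finally show "c \<bullet>\<^sub>v kron_power x k = (\<Sum>a<n. ?b a * (x $\<^sub>v a) ^ k)" .
qed

lemma N_mat_zero_imp_zero:
  assumes ms: "monomial_order n k ms" and c: "c \<in> carrier_vec (n ^ k)"
    and zero: "N_mat n k ms *\<^sub>v c = 0\<^sub>v (length ms)" and x: "x \<in> carrier_vec n"
  shows "c \<bullet>\<^sub>v kron_power x k = 0"
  using N_mat_mult_scalar_prod_monomials[OF ms c x] zero by simp

section \<open>Kronecker powers of a sum\<close>

text \<open>The vector analogue of the fold in \<open>kron_sum\<close>: the product of the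
  \<open>y i\<close> along a list, closed by the one-dimensional unit vector of
  \<open>kron_vec\<close>.\<close>

definition kron_fold :: "(nat \<Rightarrow> real Matrix.vec) \<Rightarrow> nat list \<Rightarrow> real Matrix.vec" where
  "kron_fold y is = foldr (\<lambda>i. kron_vec (y i)) is (Matrix.vec 1 (\<lambda>_. 1))"

lemma kron_fold_Nil [simp]: "kron_fold y [] = Matrix.vec 1 (\<lambda>_. 1)"
  by (simp add: kron_fold_def)

lemma kron_fold_Cons [simp]: "kron_fold y (i # is) = kron_vec (y i) (kron_fold y is)"
  by (simp add: kron_fold_def)

lemma kron_fold_carrier:
  "(\<And>i. i \<in> set is \<Longrightarrow> y i \<in> carrier_vec n) \<Longrightarrow> kron_fold y is \<in> carrier_vec (n ^ length is)"
  by (induction "is") (auto intro!: kron_vec_carrier)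

text \<open>Multilinearity: expanding the \<open>m\<close>-fold product of a sum gives one term for
  each ordered list of \<open>m\<close> indices. The entrywise form needs only sums of real
  numbers.\<close>

lemma kron_power_sum:
  assumes x: "x \<in> carrier_vec n" and y: "\<And>i. i \<in> I \<Longrightarrow> y i \<in> carrier_vec n" and I: "finite I"
    and sum: "\<And>a. a < n \<Longrightarrow> x $\<^sub>v a = (\<Sum>i\<in>I. y i $\<^sub>v a)"
  shows "j < n ^ m \<Longrightarrow>
    kron_power x m $\<^sub>v j = (\<Sum>is\<in>{is. set is \<subseteq> I \<and> length is = m}. kron_fold y is $\<^sub>v j)"
proof (induction m arbitrary: j)
  case 0
  have "{is. set is \<subseteq> I \<and> is = []} = {[]}" by auto
  then show ?case using 0 by simp
next
  case (Suc m)
  then have "0 < n ^ m" by (auto intro!: Nat.gr0I)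
  then have a: "j div n ^ m < n" and b: "j mod n ^ m < n ^ m"
    using Suc.prems by (auto simp: less_mult_imp_div_less)
  let ?Is = "{is. set is \<subseteq> I \<and> length is = m}"
  have "kron_power x (Suc m) $\<^sub>v j = x $\<^sub>v (j div n ^ m) * kron_power x m $\<^sub>v (j mod n ^ m)"
    using Suc.prems x by (simp add: kron_vec_def)
  \<comment> \<open>The tail comes first in these pairs, as in \<open>lists_length_Suc_eq\<close>,
    by which they are finally merged into lists of length \<open>Suc m\<close>.\<close>
  also have "\<dots> = (\<Sum>(is, i)\<in>?Is \<times> I. y i $\<^sub>v (j div n ^ m) * kron_fold y is $\<^sub>v (j mod n ^ m))"
    unfolding sum[OF a] Suc.IH[OF b] sum_product
    by (subst sum.swap) (rule sum.cartesian_product)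
  also have "\<dots> = (\<Sum>(is, i)\<in>?Is \<times> I. kron_fold y (i # is) $\<^sub>v j)"
  proof (intro sum.cong refl, clarsimp)
    fix "is" i assume is': "i \<in> I" "set is \<subseteq> I" "m = length is"
    then have "y i \<in> carrier_vec n" "kron_fold y is \<in> carrier_vec (n ^ m)"
      using y by (auto intro: kron_fold_carrier)
    then show "y i $\<^sub>v (j div n ^ length is) * kron_fold y is $\<^sub>v (j mod n ^ length is) =
        kron_vec (y i) (kron_fold y is) $\<^sub>v j"
      using Suc.prems is' by (simp add: kron_vec_def)
  qed
  also have "\<dots> = (\<Sum>is\<in>{is. set is \<subseteq> I \<and> length is = Suc m}. kron_fold y is $\<^sub>v j)"
    unfolding lists_length_Suc_eq
    by (subst sum.reindex) (auto simp: inj_on_def case_prod_unfold)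
  finally show ?case .
qed

lemma foldr_kron_mat_carrier:
  assumes "\<And>i. i \<in> set is \<Longrightarrow> T i \<in> carrier_mat n (n ^ i)"
  shows "foldr (\<lambda>i A. T i \<otimes>\<^sub>K A) is (1\<^sub>m 1) \<in> carrier_mat (n ^ length is) (n ^ sum_list is)"
  using assms
proof (induction "is")
  case (Cons i "is")
  then show ?case
    using kron_mat_carrier[of "T i" n "n ^ i" _ "n ^ length is" "n ^ sum_list is"]
    by (simp add: power_add)
qed simp

text \<open>The power of \<open>z\<close> splits along the parts of the list by
  \<open>kron_power_add\<close>, and the mixed product rule lets each \<open>T i\<close> act on its
  own factor.\<close>

lemma foldr_kron_mat_mult_kron_power:
  assumes "\<And>i. i \<in> set is \<Longrightarrow> T i \<in> carrier_mat n (n ^ i)" and z: "z \<in> carrier_vec n"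
  shows "foldr (\<lambda>i A. T i \<otimes>\<^sub>K A) is (1\<^sub>m 1) *\<^sub>v kron_power z (sum_list is) =
    kron_fold (\<lambda>i. T i *\<^sub>v kron_power z i) is"
  using assms(1)
proof (induction "is")
  case (Cons i "is")
  have A: "foldr (\<lambda>i A. T i \<otimes>\<^sub>K A) is (1\<^sub>m 1) \<in> carrier_mat (n ^ length is) (n ^ sum_list is)"
    using Cons.prems by (intro foldr_kron_mat_carrier) simp
  have T: "T i \<in> carrier_mat n (n ^ i)" using Cons.prems by simp
  show ?case
    using Cons.IH Cons.prems kron_mat_mult_kron_vec[of "kron_power z i" "T i" "kron_power z (sum_list is)"
      "foldr (\<lambda>i A. T i \<otimes>\<^sub>K A) is (1\<^sub>m 1)"] A T z
    by (simp add: kron_power_add)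
qed simp

section \<open>Compositions of an integer and the matrices built from them\<close>

lemma finite_compositions [simp]: "finite (compositions m l)"
proof (rule finite_subset)
  show "compositions m l \<subseteq> {is. set is \<subseteq> {..l} \<and> length is = m}"
    by (auto simp: compositions_def member_le_sum_list)
qed (simp add: finite_lists_length_eq)

text \<open>The other \<open>m - 1\<close> parts are at least 1 each. For \<open>m \<ge> 2\<close>
  every part is thus smaller than \<open>l\<close>, so the part of degree \<open>l\<close> involves
  only \<open>T i\<close> with \<open>i < l\<close>.\<close>

lemma compositions_part_le:
  assumes "is \<in> compositions m l" "i \<in> set is"
  shows "i + m \<le> l + 1" and "0 < i"
proof -
  show "0 < i" using assms by (simp add: compositions_def)
  have pos: "length js \<le> sum_list js" if "\<forall>j\<in>set js. 0 < j" for js :: "nat list"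
    using that by (induction js) auto
  obtain xs ys where is': "is = xs @ i # ys" using assms(2) by (meson split_list)
  have "length xs \<le> sum_list xs" "length ys \<le> sum_list ys"
    using assms(1) by (auto intro!: pos simp: compositions_def is')
  then show "i + m \<le> l + 1" using assms(1) by (auto simp: compositions_def is')
qed

lemma kron_sum_carrier [simp]: "kron_sum n T m l \<in> carrier_mat (n ^ m) (n ^ l)"
  by (simp add: kron_sum_def)

lemma kron_sum_mult_kron_power:
  assumes T: "\<And>i. 0 < i \<Longrightarrow> i + m \<le> l + 1 \<Longrightarrow> T i \<in> carrier_mat n (n ^ i)"
    and c: "c \<in> carrier_vec (n ^ m)" and z: "z \<in> carrier_vec n"
  shows "c \<bullet>\<^sub>v (kron_sum n T m l *\<^sub>v kron_power z l) =
    (\<Sum>is\<in>compositions m l. c \<bullet>\<^sub>v kron_fold (\<lambda>i. T i *\<^sub>v kron_power z i) is)"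
proof -
  let ?F = "\<lambda>is. foldr (\<lambda>i A. T i \<otimes>\<^sub>K A) is (1\<^sub>m 1)"
  let ?y = "\<lambda>i. T i *\<^sub>v kron_power z i"
  have Ti: "T i \<in> carrier_mat n (n ^ i)" if "is \<in> compositions m l" "i \<in> set is" for i "is"
    using compositions_part_le[OF that] by (intro T)
  have fold: "?F is *\<^sub>v kron_power z l = kron_fold ?y is" "?F is \<in> carrier_mat (n ^ m) (n ^ l)"
    if "is \<in> compositions m l" for "is"
    using foldr_kron_mat_mult_kron_power[OF Ti[OF that] z] foldr_kron_mat_carrier[OF Ti[OF that]] that
    by (auto simp: compositions_def)
  have entry: "(kron_sum n T m l *\<^sub>v kron_power z l) $\<^sub>v j = (\<Sum>is\<in>compositions m l. kron_fold ?y is $\<^sub>v j)"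
    if j: "j < n ^ m" for j
  proof -
    have "(kron_sum n T m l *\<^sub>v kron_power z l) $\<^sub>v j =
        (\<Sum>b<n ^ l. \<Sum>is\<in>compositions m l. ?F is $$ (j, b) * kron_power z l $\<^sub>v b)"
      using j z by (subst mult_mat_vec_index[where n = "n ^ l"]) (auto simp: kron_sum_def sum_distrib_right)
    also have "\<dots> = (\<Sum>is\<in>compositions m l. (?F is *\<^sub>v kron_power z l) $\<^sub>v j)"
    proof (subst sum.swap, rule sum.cong[OF refl])
      fix "is" assume "is \<in> compositions m l"
      then show "(\<Sum>b<n ^ l. ?F is $$ (j, b) * kron_power z l $\<^sub>v b) = (?F is *\<^sub>v kron_power z l) $\<^sub>v j"
        using fold(2)[of "is"] j z by (subst mult_mat_vec_index[where n = "n ^ l"]) auto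
    qed
    finally show ?thesis using fold(1) by simp
  qed
  have dim: "dim_vec (kron_fold ?y is) = n ^ m" if "is \<in> compositions m l" for "is"
    using fold[OF that] by (metis carrier_matD(1) dim_mult_mat_vec)
  have "c \<bullet>\<^sub>v (kron_sum n T m l *\<^sub>v kron_power z l) =
      (\<Sum>j<n ^ m. \<Sum>is\<in>compositions m l. c $\<^sub>v j * kron_fold ?y is $\<^sub>v j)"
    using carrier_matD(1)[OF kron_sum_carrier[of n T m l]]
    by (subst scalar_prod_sum[where n = "n ^ m"]) (auto simp: entry sum_distrib_left simp del: index_mult_mat_vec)
  also have "\<dots> = (\<Sum>is\<in>compositions m l. c \<bullet>\<^sub>v kron_fold ?y is)"
    by (subst sum.swap) (simp add: scalar_prod_sum dim)
  finally show ?thesis .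
qed

section \<open>The homogeneous parts of a transformed energy function\<close>

lemma scalar_prod_mult_mat_vec_mult_mat_vec:
  fixes A M B :: "real mat"
  assumes "A \<in> carrier_mat n p" "M \<in> carrier_mat n n" "B \<in> carrier_mat n q"
    and "x \<in> carrier_vec p" "y \<in> carrier_vec q"
  shows "(A *\<^sub>v x) \<bullet>\<^sub>v (M *\<^sub>v (B *\<^sub>v y)) = x \<bullet>\<^sub>v ((transpose_mat A * M * B) *\<^sub>v y)"
proof -
  have MBy: "M *\<^sub>v (B *\<^sub>v y) \<in> carrier_vec n" using assms by auto
  have "(A *\<^sub>v x) \<bullet>\<^sub>v (M *\<^sub>v (B *\<^sub>v y)) = x \<bullet>\<^sub>v (transpose_mat A *\<^sub>v (M *\<^sub>v (B *\<^sub>v y)))"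
    using transpose_vec_mult_scalar[OF assms(1,4) MBy] assms MBy
    by (metis comm_scalar_prod mult_mat_vec_carrier transpose_carrier_mat)
  also have "\<dots> = x \<bullet>\<^sub>v ((transpose_mat A * M * B) *\<^sub>v y)"
    using assms by (simp add: assoc_mult_mat_vec[of _ p n _ q] assoc_mult_mat_vec[of _ p n _ n])
  finally show ?thesis .
qed

lemma scalar_prod_symmetric:
  fixes M :: "real mat"
  assumes "M \<in> carrier_mat n n" "transpose_mat M = M" "x \<in> carrier_vec n" "y \<in> carrier_vec n"
  shows "x \<bullet>\<^sub>v (M *\<^sub>v y) = y \<bullet>\<^sub>v (M *\<^sub>v x)"
  using transpose_vec_mult_scalar[OF assms(1,4,3)] assms
  by (metis comm_scalar_prod mult_mat_vec_carrier)

text \<open>The columns of the product belong to \<open>B\<close>, so \<open>B\<close> receives the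
  first \<open>i\<close> of the \<open>i + j\<close> Kronecker factors and \<open>A\<close> the
  remaining \<open>j\<close>.\<close>

lemma vectorize_product_scalar_prod_kron_power:
  assumes "A \<in> carrier_mat n (n ^ j)" "M \<in> carrier_mat n n" "B \<in> carrier_mat n (n ^ i)" "z \<in> carrier_vec n"
  shows "vectorize (transpose_mat A * M * B) \<bullet>\<^sub>v kron_power z (i + j) =
    (A *\<^sub>v kron_power z j) \<bullet>\<^sub>v (M *\<^sub>v (B *\<^sub>v kron_power z i))"
  using assms
  by (subst scalar_prod_mult_mat_vec_mult_mat_vec[of _ n "n ^ j" _ _ "n ^ i"])
     (auto intro!: kron_power_carrier vectorize_scalar_prod_kron simp: kron_power_add)

lemma kron_vec_one_right: "kron_vec x (Matrix.vec (Suc 0) (\<lambda>_. 1)) = x"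
  by (rule eq_vecI) (auto simp: kron_vec_def)

lemma compositions_2: "compositions 2 l = (\<lambda>i. [i, l - i]) ` {1..<l}"
proof -
  have "is \<in> (\<lambda>i. [i, l - i]) ` {1..<l}" if is2: "is \<in> compositions 2 l" for "is"
  proof -
    obtain i j where "is = [i, j]"
      using is2 by (auto simp: compositions_def length_Suc_conv numeral_2_eq_2)
    then show ?thesis using is2 by (auto simp: compositions_def intro!: image_eqI[of _ _ i])
  qed
  then show ?thesis by (auto simp: compositions_def)
qed

text \<open>Substituting \<open>\<Sum>\<^sub>i T\<^sub>i z\<^sup>i\<close> into \<open>\<Sum>\<^sub>m c\<^sub>m \<bullet> x\<^sup>m\<close> (Kronecker powers) and collecting the terms of degree \<open>l\<close>.\<close>

definition pullback_part ::
    "(nat \<Rightarrow> real mat) \<Rightarrow> (nat \<Rightarrow> real Matrix.vec) \<Rightarrow> nat \<Rightarrow> real Matrix.vec \<Rightarrow> real" where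
  "pullback_part T c l z =
    (\<Sum>m=2..l. \<Sum>is\<in>compositions m l. c m \<bullet>\<^sub>v kron_fold (\<lambda>i. T i *\<^sub>v kron_power z i) is)"

text \<open>The compositions into two parts are the lists \<open>[i, l - i]\<close>, and a
  coefficient of the form \<open>vectorize M\<close> pairs the two factors through the bilinear form
  of \<open>M\<close>.\<close>

lemma pullback_part_bilinear:
  assumes T: "\<And>i. 0 < i \<Longrightarrow> i < l \<Longrightarrow> T i \<in> carrier_mat n (n ^ i)"
    and M: "M \<in> carrier_mat n n" and z: "z \<in> carrier_vec n"
  shows "(\<Sum>is\<in>compositions 2 l. vectorize M \<bullet>\<^sub>v kron_fold (\<lambda>i. T i *\<^sub>v kron_power z i) is) =
    (\<Sum>i=1..<l. (T (l - i) *\<^sub>v kron_power z (l - i)) \<bullet>\<^sub>v (M *\<^sub>v (T i *\<^sub>v kron_power z i)))"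
proof -
  have "(\<Sum>is\<in>compositions 2 l. vectorize M \<bullet>\<^sub>v kron_fold (\<lambda>i. T i *\<^sub>v kron_power z i) is) =
      (\<Sum>i=1..<l. vectorize M \<bullet>\<^sub>v kron_vec (T i *\<^sub>v kron_power z i) (T (l - i) *\<^sub>v kron_power z (l - i)))"
    unfolding compositions_2 by (subst sum.reindex) (auto simp: inj_on_def kron_vec_one_right)
  also have "\<dots> = (\<Sum>i=1..<l. (T (l - i) *\<^sub>v kron_power z (l - i)) \<bullet>\<^sub>v (M *\<^sub>v (T i *\<^sub>v kron_power z i)))"
  proof (rule sum.cong[OF refl])
    fix i assume "i \<in> {1..<l}"
    then show "vectorize M \<bullet>\<^sub>v kron_vec (T i *\<^sub>v kron_power z i) (T (l - i) *\<^sub>v kron_power z (l - i)) =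
        (T (l - i) *\<^sub>v kron_power z (l - i)) \<bullet>\<^sub>v (M *\<^sub>v (T i *\<^sub>v kron_power z i))"
      using z T[of i] T[of "l - i"]
      by (intro vectorize_scalar_prod_kron[OF M] mult_mat_vec_carrier[OF T] kron_power_carrier) auto
  qed
  finally show ?thesis .
qed

text \<open>The first two claims are the side conditions under which the rules for
  \<open>finsum_vec\<close> apply to the two sums in \<open>lower_terms\<close>.\<close>

lemma lower_terms_carrier:
  assumes T: "\<And>i. 0 < i \<Longrightarrow> i < l \<Longrightarrow> T i \<in> carrier_mat n (n ^ i)" and M: "M \<in> carrier_mat n n"
    and c: "\<And>m. m \<in> {3..l} \<Longrightarrow> c m \<in> carrier_vec (n ^ m)"
  shows "(\<lambda>(i, j). vectorize (transpose_mat (T j) * M * T i)) \<in>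
      {(i, j). 2 \<le> i \<and> 2 \<le> j \<and> i + j = l} \<rightarrow> carrier_vec (n ^ l)"
    and "(\<lambda>i. transpose_mat (kron_sum n T i l) *\<^sub>v c i) \<in> {3..l} \<rightarrow> carrier_vec (n ^ l)"
    and "lower_terms n T M c l \<in> carrier_vec (n ^ l)"
proof -
  have "vectorize (transpose_mat (T j) * M * T i) \<in> carrier_vec (n ^ l)"
    if "2 \<le> i" "2 \<le> j" "i + j = l" for i j
    using vectorize_carrier[of "transpose_mat (T j) * M * T i" "n ^ j" "n ^ i"]
      T[of i] T[of j] M that by (auto simp: power_add mult.commute)
  then show 1: "(\<lambda>(i, j). vectorize (transpose_mat (T j) * M * T i)) \<in>
      {(i, j). 2 \<le> i \<and> 2 \<le> j \<and> i + j = l} \<rightarrow> carrier_vec (n ^ l)" by auto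
  show 2: "(\<lambda>i. transpose_mat (kron_sum n T i l) *\<^sub>v c i) \<in> {3..l} \<rightarrow> carrier_vec (n ^ l)"
    using c kron_sum_carrier[of n T _ l]
    by (intro Pi_I mult_mat_vec_carrier[of _ "n ^ l" "n ^ _"]) auto
  show "lower_terms n T M c l \<in> carrier_vec (n ^ l)"
    unfolding lower_terms_def by (intro add_carrier_vec finsum_vec_closed 1 2)
qed

lemma finsum_vec_scalar_prod:
  fixes F :: "'i \<Rightarrow> real Matrix.vec"
  assumes "finite I" "F \<in> I \<rightarrow> carrier_vec N" "x \<in> carrier_vec N"
  shows "finsum_vec TYPE(real) N F I \<bullet>\<^sub>v x = (\<Sum>i\<in>I. F i \<bullet>\<^sub>v x)"
  using assms
  by (simp add: scalar_prod_sum[where n = N] index_finsum_vec sum_distrib_right sum.swap[of _ I])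

lemma lower_terms_scalar_prod_kron_power:
  assumes T: "\<And>i. 0 < i \<Longrightarrow> i < l \<Longrightarrow> T i \<in> carrier_mat n (n ^ i)" and M: "M \<in> carrier_mat n n"
    and c: "\<And>m. m \<in> {3..l} \<Longrightarrow> c m \<in> carrier_vec (n ^ m)" and z: "z \<in> carrier_vec n"
  shows "lower_terms n T M c l \<bullet>\<^sub>v kron_power z l =
    (\<Sum>i=2..<l - 1. (T (l - i) *\<^sub>v kron_power z (l - i)) \<bullet>\<^sub>v (M *\<^sub>v (T i *\<^sub>v kron_power z i))) +
    (\<Sum>m=3..l. \<Sum>is\<in>compositions m l. c m \<bullet>\<^sub>v kron_fold (\<lambda>i. T i *\<^sub>v kron_power z i) is)"
proof -
  let ?P = "{(i, j). 2 \<le> i \<and> 2 \<le> j \<and> i + j = l}"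
  let ?F = "\<lambda>(i, j). vectorize (transpose_mat (T j) * M * T i)"
  let ?G = "\<lambda>i. transpose_mat (kron_sum n T i l) *\<^sub>v c i"
  note carrier = lower_terms_carrier[of l T n M c, OF T M c]
  \<comment> \<open>Both \<open>i\<close> and \<open>l - i\<close> are at least 2 exactly when
    \<open>2 \<le> i < l - 1\<close>; the range is empty for \<open>l = 3\<close>.\<close>
  have P: "?P = (\<lambda>i. (i, l - i)) ` {2..<l - 1}" by force
  have zl: "kron_power z l \<in> carrier_vec (n ^ l)" using z by (rule kron_power_carrier)
  have "finsum_vec TYPE(real) (n ^ l) ?F ?P \<bullet>\<^sub>v kron_power z l =
      (\<Sum>i=2..<l - 1. (T (l - i) *\<^sub>v kron_power z (l - i)) \<bullet>\<^sub>v (M *\<^sub>v (T i *\<^sub>v kron_power z i)))"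
  proof (subst finsum_vec_scalar_prod[OF _ carrier(1) zl])
    have "?F (i, l - i) \<bullet>\<^sub>v kron_power z l =
        (T (l - i) *\<^sub>v kron_power z (l - i)) \<bullet>\<^sub>v (M *\<^sub>v (T i *\<^sub>v kron_power z i))"
      if "i \<in> {2..<l - 1}" for i
      using vectorize_product_scalar_prod_kron_power[OF T M T z, of "l - i" i] that
      by (simp add: less_diff_conv)
    then show "(\<Sum>i\<in>?P. ?F i \<bullet>\<^sub>v kron_power z l) =
      (\<Sum>i=2..<l - 1. (T (l - i) *\<^sub>v kron_power z (l - i)) \<bullet>\<^sub>v (M *\<^sub>v (T i *\<^sub>v kron_power z i)))"
      unfolding P by (subst sum.reindex) (auto simp: inj_on_def)
  qed (auto simp: P)
  moreover have "finsum_vec TYPE(real) (n ^ l) ?G {3..l} \<bullet>\<^sub>v kron_power z l =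
      (\<Sum>m=3..l. \<Sum>is\<in>compositions m l. c m \<bullet>\<^sub>v kron_fold (\<lambda>i. T i *\<^sub>v kron_power z i) is)"
  proof (subst finsum_vec_scalar_prod[OF _ carrier(2) zl], simp_all only: finite_atLeastAtMost, rule sum.cong[OF refl])
    fix m assume m: "m \<in> {3..l}"
    then have "?G m \<bullet>\<^sub>v kron_power z l = c m \<bullet>\<^sub>v (kron_sum n T m l *\<^sub>v kron_power z l)"
      using transpose_vec_mult_scalar[OF kron_sum_carrier zl c[OF m]] by simp
    then show "?G m \<bullet>\<^sub>v kron_power z l =
        (\<Sum>is\<in>compositions m l. c m \<bullet>\<^sub>v kron_fold (\<lambda>i. T i *\<^sub>v kron_power z i) is)"
      using m by (simp add: kron_sum_mult_kron_power[OF T c[OF m] z])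
  qed
  ultimately show ?thesis
    unfolding lower_terms_def
    using carrier(1,2) zl by (subst add_scalar_prod_distrib[where n = "n ^ l"]) (auto intro!: finsum_vec_closed)
qed

lemma leading_term_eq:
  assumes T: "\<And>i. 0 < i \<Longrightarrow> i < l \<Longrightarrow> T i \<in> carrier_mat n (n ^ i)" and M: "M \<in> carrier_mat n n"
    and l: "3 \<le> l"
  shows "(1\<^sub>m (n ^ (l - 1)) \<otimes>\<^sub>K (transpose_mat (T 1) * M)) *\<^sub>v vectorize (T (l - 1)) =
    vectorize (transpose_mat (T 1) * M * T (l - 1))"
  using T[of 1] T[of "l - 1"] M l by (subst kron_id_mult_vectorize[of _ n n]) auto

lemma leading_term_carrier:
  assumes T: "\<And>i. 0 < i \<Longrightarrow> i < l \<Longrightarrow> T i \<in> carrier_mat n (n ^ i)" and M: "M \<in> carrier_mat n n"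
    and l: "3 \<le> l"
  shows "(1\<^sub>m (n ^ (l - 1)) \<otimes>\<^sub>K (transpose_mat (T 1) * M)) *\<^sub>v vectorize (T (l - 1)) \<in> carrier_vec (n ^ l)"
proof -
  have "n * n ^ (l - 1) = n ^ l" using l by (metis Suc_diff_1 not_numeral_le_zero gr0I power_Suc)
  moreover have "transpose_mat (T 1) * M * T (l - 1) \<in> carrier_mat n (n ^ (l - 1))"
    using T[of 1] T[of "l - 1"] M l by auto
  ultimately show ?thesis
    using vectorize_carrier leading_term_eq[of l T n M, OF T M l] by metis
qed

text \<open>Symmetry of \<open>M\<close> makes the pairs \<open>(1, l - 1)\<close> and
  \<open>(l - 1, 1)\<close> contribute equally, which is the factor 2 of the equations. The
  remaining pairs and all terms with \<open>m \<ge> 3\<close> form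
  \<open>lower_terms\<close>.\<close>

lemma pullback_part_eq:
  assumes T: "\<And>i. 0 < i \<Longrightarrow> i < l \<Longrightarrow> T i \<in> carrier_mat n (n ^ i)"
    and M: "M \<in> carrier_mat n n" "transpose_mat M = M"
    and c: "\<And>m. m \<in> {3..l} \<Longrightarrow> c m \<in> carrier_vec (n ^ m)" and c2: "c 2 = vectorize M"
    and z: "z \<in> carrier_vec n" and l: "3 \<le> l"
  shows "pullback_part T c l z =
    (2 \<cdot>\<^sub>v ((1\<^sub>m (n ^ (l - 1)) \<otimes>\<^sub>K (transpose_mat (T 1) * M)) *\<^sub>v vectorize (T (l - 1))) +
      lower_terms n T M c l) \<bullet>\<^sub>v kron_power z l" (is "_ = (2 \<cdot>\<^sub>v ?X + ?L) \<bullet>\<^sub>v _")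
proof -
  let ?b = "\<lambda>i j. (T j *\<^sub>v kron_power z j) \<bullet>\<^sub>v (M *\<^sub>v (T i *\<^sub>v kron_power z i))"
  let ?H = "\<Sum>m=3..l. \<Sum>is\<in>compositions m l. c m \<bullet>\<^sub>v kron_fold (\<lambda>i. T i *\<^sub>v kron_power z i) is"
  have T1: "T 1 \<in> carrier_mat n n" and Tl: "T (l - 1) \<in> carrier_mat n (n ^ (l - 1))"
    using T[of 1] T[of "l - 1"] l by auto
  have X: "?X = vectorize (transpose_mat (T 1) * M * T (l - 1))"
    by (rule leading_term_eq[OF T M(1) l])
  have XC: "?X \<in> carrier_vec (n ^ l)"
    by (rule leading_term_carrier[OF T M(1) l])
  have LC: "?L \<in> carrier_vec (n ^ l)" using lower_terms_carrier(3)[of l T n M c, OF T M(1) c] .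
  have "?X \<bullet>\<^sub>v kron_power z l = ?b (l - 1) 1"
    unfolding X using vectorize_product_scalar_prod_kron_power[of "T 1" n 1 M "T (l - 1)" "l - 1" z] T1 Tl M z l
    by simp
  moreover have "?b 1 (l - 1) = ?b (l - 1) 1"
    using T1 Tl z by (intro scalar_prod_symmetric[OF M]) (auto intro!: mult_mat_vec_carrier kron_power_carrier simp: kron_vec_one_right)
  moreover have "pullback_part T c l z = (\<Sum>i=1..<l. ?b i (l - i)) + ?H"
  proof -
    have "{2..l} = insert 2 {3..l}" using l by auto
    then show ?thesis
      using pullback_part_bilinear[OF T M(1) z] c2 by (simp add: pullback_part_def)
  qed
  moreover have "(\<Sum>i=1..<l. ?b i (l - i)) = ?b 1 (l - 1) + ?b (l - 1) 1 + (\<Sum>i=2..<l - 1. ?b i (l - i))"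
  proof -
    \<comment> \<open>For \<open>l \<ge> 3\<close> the end points 1 and \<open>l - 1\<close> differ,
      so two separate summands split off; for \<open>l = 2\<close> they would coincide.\<close>
    have "{1..<l} = insert 1 (insert (l - 1) {2..<l - 1})" using l by auto
    then show ?thesis using l by simp
  qed
  moreover have "?L \<bullet>\<^sub>v kron_power z l = (\<Sum>i=2..<l - 1. ?b i (l - i)) + ?H"
    using lower_terms_scalar_prod_kron_power[OF T M(1) c z] by simp
  moreover have "(2 \<cdot>\<^sub>v ?X + ?L) \<bullet>\<^sub>v kron_power z l = 2 * (?X \<bullet>\<^sub>v kron_power z l) + ?L \<bullet>\<^sub>v kron_power z l"
    using XC LC kron_power_carrier[OF z, of l]
    by (subst add_scalar_prod_distrib[where n = "n ^ l"]) auto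
  ultimately show ?thesis by simp
qed

section \<open>Remainder estimates\<close>

lemma abs_kron_power_le:
  assumes "\<And>a. a < dim_vec x \<Longrightarrow> \<bar>x $\<^sub>v a\<bar> \<le> B"
  shows "j < dim_vec x ^ k \<Longrightarrow> \<bar>kron_power x k $\<^sub>v j\<bar> \<le> B ^ k"
proof (induction k arbitrary: j)
  case (Suc k)
  then have "0 < dim_vec x ^ k" by (auto intro!: Nat.gr0I)
  then have j: "j div dim_vec x ^ k < dim_vec x" "j mod dim_vec x ^ k < dim_vec x ^ k"
    using Suc.prems by (auto simp: less_mult_imp_div_less)
  have "0 \<le> B" using assms[OF j(1)] by linarith
  then show ?case
    using Suc.prems assms[OF j(1)] Suc.IH[OF j(2)]
    by (auto simp: kron_vec_def abs_mult intro!: mult_mono)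
qed simp

lemma coord_vec_carrier: "coord_vec idx (z :: real ^ 'n) \<in> carrier_vec CARD('n)"
  by (auto simp: coord_vec_def intro: carrier_vecI)

lemma dim_coord_vec [simp]: "dim_vec (coord_vec idx (z :: real ^ 'n)) = CARD('n)"
  by (simp add: coord_vec_def)

lemma coord_vec_index:
  fixes z :: "real ^ 'n"
  assumes "bij_betw idx UNIV {..<CARD('n)}"
  shows "coord_vec idx z $\<^sub>v idx i = z $ i"
proof -
  have "idx i < CARD('n)" using assms by (auto simp: bij_betw_def)
  then show ?thesis using assms by (simp add: coord_vec_def bij_betw_def)
qed

lemma abs_scalar_prod_kron_power_le:
  fixes z :: "real ^ 'n"
  assumes "u \<in> carrier_vec (CARD('n) ^ k)"
  shows "\<bar>u \<bullet>\<^sub>v kron_power (coord_vec idx z) k\<bar> \<le> (\<Sum>j<CARD('n) ^ k. \<bar>u $\<^sub>v j\<bar>) * norm z ^ k"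
proof -
  have "\<bar>coord_vec idx z $\<^sub>v a\<bar> \<le> norm z" if "a < dim_vec (coord_vec idx z)" for a
    using that component_le_norm_cart[of z] by (simp add: coord_vec_def)
  then have "\<bar>kron_power (coord_vec idx z) k $\<^sub>v j\<bar> \<le> norm z ^ k" if "j < CARD('n) ^ k" for j
    using that by (intro abs_kron_power_le) auto
  then have "\<bar>\<Sum>j<CARD('n) ^ k. u $\<^sub>v j * kron_power (coord_vec idx z) k $\<^sub>v j\<bar> \<le>
      (\<Sum>j<CARD('n) ^ k. \<bar>u $\<^sub>v j\<bar> * norm z ^ k)"
    by (intro order.trans[OF sum_abs] sum_mono) (auto simp: abs_mult intro!: mult_left_mono)
  then show ?thesis
    using assms by (simp add: scalar_prod_sum sum_distrib_right)
qed

text \<open>The pairing is bounded by the sum of the absolute entries of \<open>u\<close> times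
  \<open>norm z ^ k\<close>, and inside the unit ball a higher power of the norm is at most a lower
  one.\<close>

lemma scalar_prod_kron_power_bigo:
  fixes u :: "real Matrix.vec"
  assumes "u \<in> carrier_vec (CARD('n) ^ k)" "p \<le> k"
  shows "(\<lambda>z :: real ^ 'n. u \<bullet>\<^sub>v kron_power (coord_vec idx z) k) \<in> O[at 0](\<lambda>z. norm z ^ p)"
proof (rule bigoI)
  let ?C = "\<Sum>j<CARD('n) ^ k. \<bar>u $\<^sub>v j\<bar>"
  have "\<forall>\<^sub>F z :: real ^ 'n in at 0. norm z < 1"
    unfolding eventually_at by (intro exI[of _ 1]) auto
  then show "\<forall>\<^sub>F z :: real ^ 'n in at 0. norm (u \<bullet>\<^sub>v kron_power (coord_vec idx z) k) \<le> ?C * norm (norm z ^ p)"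
  proof eventually_elim
    case (elim z)
    have "\<bar>u \<bullet>\<^sub>v kron_power (coord_vec idx z) k\<bar> \<le> ?C * norm z ^ k"
      by (rule abs_scalar_prod_kron_power_le) fact
    also have "\<dots> \<le> ?C * norm z ^ p"
      using elim assms(2) by (intro mult_left_mono power_decreasing sum_nonneg) auto
    finally show ?case by simp
  qed
qed

lemma coord_vec_poly_transformation:
  fixes z :: "real ^ 'n"
  assumes "bij_betw idx UNIV {..<CARD('n)}" "a < CARD('n)"
  shows "coord_vec idx (poly_transformation idx D T z) $\<^sub>v a =
    (\<Sum>k=1..D. (T k *\<^sub>v kron_power (coord_vec idx z) k) $\<^sub>v a)"
proof -
  have "idx (inv_into UNIV idx a) = a" using assms by (simp add: bij_betw_def f_inv_into_f)
  then show ?thesis using assms by (simp add: coord_vec_def poly_transformation_def)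
qed

text \<open>Each coordinate is a sum of homogeneous terms of degree at least 1, and the norm is at
  most the sum of the absolute coordinates.\<close>

lemma norm_poly_transformation_bigo:
  fixes T :: "nat \<Rightarrow> real mat"
  assumes idx: "bij_betw idx UNIV {..<CARD('n)}"
    and T: "\<And>i. i \<in> {1..D} \<Longrightarrow> T i \<in> carrier_mat CARD('n) (CARD('n) ^ i)"
  shows "(\<lambda>z :: real ^ 'n. norm (poly_transformation idx D T z)) \<in> O[at 0](\<lambda>z. norm z)"
proof -
  have "(\<lambda>z :: real ^ 'n. poly_transformation idx D T z $ i) \<in> O[at 0](\<lambda>z. norm z)" for i
  proof -
    have a: "idx i < CARD('n)" using idx by (auto simp: bij_betw_def)
    have "(\<lambda>z :: real ^ 'n. \<Sum>k=1..D. Matrix.row (T k) (idx i) \<bullet>\<^sub>v kron_power (coord_vec idx z) k)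
        \<in> O[at 0](\<lambda>z. norm z ^ 1)"
      using T a by (intro big_sum_in_bigo scalar_prod_kron_power_bigo row_carrier_vec) auto
    moreover have "poly_transformation idx D T z $ i =
        (\<Sum>k=1..D. Matrix.row (T k) (idx i) \<bullet>\<^sub>v kron_power (coord_vec idx z) k)" for z :: "real ^ 'n"
    proof -
      have "dim_row (T k) = CARD('n)" if "k \<in> {1..D}" for k using T[OF that] by blast
      then show ?thesis
        unfolding poly_transformation_def vec_lambda_beta
        using a by (intro sum.cong refl index_mult_mat_vec) simp
    qed
    ultimately show ?thesis by simp
  qed
  then have "(\<lambda>z :: real ^ 'n. \<Sum>i\<in>UNIV. \<bar>poly_transformation idx D T z $ i\<bar>) \<in> O[at 0](\<lambda>z. norm z)"
    by (intro big_sum_in_bigo) simp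
  moreover have "(\<lambda>z :: real ^ 'n. norm (poly_transformation idx D T z)) \<in>
      O[at 0](\<lambda>z. \<Sum>i\<in>UNIV. \<bar>poly_transformation idx D T z $ i\<bar>)"
    by (intro bigoI[of _ 1] always_eventually) (simp add: norm_le_l1_cart sum_nonneg)
  ultimately show ?thesis by (rule landau_o.big_trans[rotated])
qed

text \<open>The filter \<open>at 0\<close> leaves out the point 0, but \<Phi> may take the value 0
  at nonzero \<open>z\<close>. The assumption \<open>r 0 = 0\<close> extends the estimate to a full
  neighbourhood, into which \<Phi> eventually maps.\<close>

lemma bigo_compose_at_0:
  fixes r :: "'a::real_normed_vector \<Rightarrow> real" and \<Phi> :: "'b::real_normed_vector \<Rightarrow> 'a"
  assumes r: "r \<in> O[at 0](\<lambda>x. norm x ^ p)" and r0: "r 0 = 0"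
    and \<Phi>: "(\<lambda>z. norm (\<Phi> z)) \<in> O[at 0](\<lambda>z. norm z)"
  shows "(\<lambda>z. r (\<Phi> z)) \<in> O[at 0](\<lambda>z. norm z ^ p)"
proof -
  obtain C where C: "0 < C" "\<forall>\<^sub>F x in at 0. norm (r x) \<le> C * norm (norm x ^ p)"
    using landau_o.bigE[OF r] by blast
  obtain K where K: "0 < K" "\<forall>\<^sub>F z in at 0. norm (norm (\<Phi> z)) \<le> K * norm (norm z)"
    using landau_o.bigE[OF \<Phi>] by blast
  have "\<forall>\<^sub>F x in nhds 0. norm (r x) \<le> C * norm x ^ p"
    unfolding eventually_nhds_conv_at using C r0 by auto
  moreover have "filterlim \<Phi> (nhds 0) (at 0)"
  proof (rule Lim_null_comparison)
    show "\<forall>\<^sub>F z in at 0. norm (\<Phi> z) \<le> K * norm z" using K by simp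
    show "((\<lambda>z. K * norm z) \<longlongrightarrow> 0) (at 0)" by (intro tendsto_eq_intros) auto
  qed
  ultimately have "\<forall>\<^sub>F z in at 0. norm (r (\<Phi> z)) \<le> C * norm (\<Phi> z) ^ p"
    by (rule eventually_compose_filterlim)
  with K(2) have "\<forall>\<^sub>F z in at 0. norm (r (\<Phi> z)) \<le> (C * K ^ p) * norm (norm z ^ p)"
  proof eventually_elim
    case (elim z)
    have "norm (\<Phi> z) ^ p \<le> (K * norm z) ^ p" using elim by (intro power_mono) auto
    then have "C * norm (\<Phi> z) ^ p \<le> C * (K * norm z) ^ p" using C by simp
    then show ?case using elim by (simp add: power_mult_distrib mult.assoc)
  qed
  then show ?thesis by (rule bigoI)
qed

section \<open>Splitting the substituted Taylor polynomial at degree \<open>d\<close>\<close>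

lemma compositions_empty: "2 \<le> m \<Longrightarrow> l < m \<Longrightarrow> compositions m l = {}"
proof (rule ccontr)
  assume m: "2 \<le> m" "l < m" and "compositions m l \<noteq> {}"
  then obtain "is" where is': "is \<in> compositions m l" by blast
  then have "is \<noteq> []" using m by (auto simp: compositions_def)
  then show False using compositions_part_le[OF is', of "hd is"] m by auto
qed

text \<open>Parts of a composition of \<open>l \<le> d\<close> into at least two parts are automatically at most \<open>d - 1\<close>,
  so truncating the transformation at degree \<open>d - 1\<close> does not affect the terms up to degree \<open>d\<close>.\<close>

lemma sum_lists_split_degree:
  fixes F :: "nat list \<Rightarrow> real"
  assumes m: "2 \<le> m"
  shows "(\<Sum>is\<in>{is. set is \<subseteq> {1..d - 1} \<and> length is = m}. F is) =
    (\<Sum>l=2..d. \<Sum>is\<in>compositions m l. F is) +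
    (\<Sum>is\<in>{is. set is \<subseteq> {1..d - 1} \<and> length is = m \<and> d < sum_list is}. F is)"
proof -
  let ?A = "{is. set is \<subseteq> {1..d - 1} \<and> length is = m}"
  have A: "finite ?A" by (simp add: finite_lists_length_eq)
  have low: "{is \<in> ?A. sum_list is \<le> d} = (\<Union>l\<in>{2..d}. compositions m l)"
  proof (intro subset_antisym subsetI)
    fix "is" assume "is \<in> {is \<in> ?A. sum_list is \<le> d}"
    then have isd: "is \<in> compositions m (sum_list is)" "sum_list is \<le> d" by (auto simp: compositions_def)
    then have "2 \<le> sum_list is"
      using compositions_empty[OF m, of "sum_list is"] m by (cases "sum_list is < m") auto
    then show "is \<in> (\<Union>l\<in>{2..d}. compositions m l)" using isd by auto
  next
    fix "is" assume "is \<in> (\<Union>l\<in>{2..d}. compositions m l)"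
    then obtain l where l: "l \<le> d" "is \<in> compositions m l" by auto
    have "i \<in> {1..d - 1}" if "i \<in> set is" for i
      using compositions_part_le[OF l(2) that] l(1) m by auto
    then show "is \<in> {is \<in> ?A. sum_list is \<le> d}" using l by (auto simp: compositions_def)
  qed
  have high: "?A - {is \<in> ?A. sum_list is \<le> d} =
      {is. set is \<subseteq> {1..d - 1} \<and> length is = m \<and> d < sum_list is}" by auto
  have "sum F ?A = sum F {is \<in> ?A. sum_list is \<le> d} + sum F (?A - {is \<in> ?A. sum_list is \<le> d})"
    using A by (subst sum.subset_diff[of "{is \<in> ?A. sum_list is \<le> d}"]) (auto simp: add.commute)
  also have "sum F {is \<in> ?A. sum_list is \<le> d} = (\<Sum>l=2..d. \<Sum>is\<in>compositions m l. F is)"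
    unfolding low
  proof (rule sum.UNION_disjoint)
    show "\<forall>l\<in>{2..d}. \<forall>l'\<in>{2..d}. l \<noteq> l' \<longrightarrow> compositions m l \<inter> compositions m l' = {}"
      by (auto simp: compositions_def)
  qed simp_all
  finally show ?thesis unfolding high .
qed

text \<open>The product is homogeneous of degree \<open>sum_list is\<close>: moving the matrix
  product to \<open>c\<close> by transposition leaves a pairing with a single Kronecker
  power.\<close>

lemma kron_fold_bigo:
  fixes T :: "nat \<Rightarrow> real mat" and c :: "real Matrix.vec"
  assumes T: "\<And>i. i \<in> set is \<Longrightarrow> T i \<in> carrier_mat CARD('n) (CARD('n) ^ i)"
    and c: "c \<in> carrier_vec (CARD('n) ^ length is)" and p: "p \<le> sum_list is"
  shows "(\<lambda>z :: real ^ 'n. c \<bullet>\<^sub>v kron_fold (\<lambda>i. T i *\<^sub>v kron_power (coord_vec idx z) i) is)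
    \<in> O[at 0](\<lambda>z. norm z ^ p)"
proof -
  let ?F = "foldr (\<lambda>i A. T i \<otimes>\<^sub>K A) is (1\<^sub>m 1)"
  have F: "?F \<in> carrier_mat (CARD('n) ^ length is) (CARD('n) ^ sum_list is)"
    by (rule foldr_kron_mat_carrier[OF T])
  have "(\<lambda>z :: real ^ 'n. (transpose_mat ?F *\<^sub>v c) \<bullet>\<^sub>v kron_power (coord_vec idx z) (sum_list is))
      \<in> O[at 0](\<lambda>z. norm z ^ p)"
    using F c p
    by (intro scalar_prod_kron_power_bigo mult_mat_vec_carrier[of _ _ "CARD('n) ^ length is"]) auto
  moreover have "(transpose_mat ?F *\<^sub>v c) \<bullet>\<^sub>v kron_power (coord_vec idx z) (sum_list is) =
      c \<bullet>\<^sub>v kron_fold (\<lambda>i. T i *\<^sub>v kron_power (coord_vec idx z) i) is" for z :: "real ^ 'n"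
    using transpose_vec_mult_scalar[OF F kron_power_carrier[OF coord_vec_carrier] c]
      foldr_kron_mat_mult_kron_power[OF T coord_vec_carrier] by simp
  ultimately show ?thesis by simp
qed

text \<open>The error has two sources: the Taylor remainder of \<open>E\<close>, composed with the
  transformation, and those products in the substituted Taylor polynomial whose total degree exceeds
  \<open>d\<close>.\<close>

lemma energy_pullback_expansion:
  fixes E :: "real ^ 'n \<Rightarrow> real" and c :: "nat \<Rightarrow> real Matrix.vec" and T :: "nat \<Rightarrow> real mat"
  assumes idx: "bij_betw idx UNIV {..<CARD('n)}"
    and T: "\<And>i. i \<in> {1..d - 1} \<Longrightarrow> T i \<in> carrier_mat CARD('n) (CARD('n) ^ i)"
    and c: "\<And>i. i \<in> {2..d} \<Longrightarrow> c i \<in> carrier_vec (CARD('n) ^ i)"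
    and E: "(\<lambda>x. E x - 1 / 2 * (\<Sum>i=2..d. c i \<bullet>\<^sub>v kron_power (coord_vec idx x) i))
      \<in> O[at 0](\<lambda>x. norm x ^ (d + 1))"
    and E0: "E 0 = 0"
  shows "(\<lambda>z. E (poly_transformation idx (d - 1) T z) -
      1 / 2 * (\<Sum>l=2..d. pullback_part T c l (coord_vec idx z))) \<in> O[at 0](\<lambda>z. norm z ^ (d + 1))"
proof -
  let ?\<Phi> = "poly_transformation idx (d - 1) T"
  let ?y = "\<lambda>z i. T i *\<^sub>v kron_power (coord_vec idx z) i"
  let ?A = "\<lambda>m. {is. set is \<subseteq> {1..d - 1} \<and> length is = m \<and> d < sum_list is}"
  let ?r = "\<lambda>x. E x - 1 / 2 * (\<Sum>i=2..d. c i \<bullet>\<^sub>v kron_power (coord_vec idx x) i)"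
  \<comment> \<open>The Taylor polynomial has no constant term, so the remainder at 0 equals
    \<open>E 0\<close>; \<open>bigo_compose_at_0\<close> requires this value to vanish.\<close>
  have "c i \<bullet>\<^sub>v kron_power (coord_vec idx (0 :: real ^ 'n)) i = 0" if "i \<in> {2..d}" for i
    using abs_scalar_prod_kron_power_le[OF c[OF that], of idx 0] that by (simp add: power_0_left)
  then have "?r 0 = 0" using E0 by simp
  then have remainder: "(\<lambda>z. ?r (?\<Phi> z)) \<in> O[at 0](\<lambda>z. norm z ^ (d + 1))"
    by (intro bigo_compose_at_0[OF E] norm_poly_transformation_bigo idx T)
  have tail: "(\<lambda>z :: real ^ 'n. \<Sum>m=2..d. \<Sum>is\<in>?A m. c m \<bullet>\<^sub>v kron_fold (?y z) is)
      \<in> O[at 0](\<lambda>z. norm z ^ (d + 1))"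
    using T c by (intro big_sum_in_bigo kron_fold_bigo) auto
  have expand: "c m \<bullet>\<^sub>v kron_power (coord_vec idx (?\<Phi> z)) m =
      (\<Sum>l=2..d. \<Sum>is\<in>compositions m l. c m \<bullet>\<^sub>v kron_fold (?y z) is) +
      (\<Sum>is\<in>?A m. c m \<bullet>\<^sub>v kron_fold (?y z) is)" if m: "m \<in> {2..d}" for m and z :: "real ^ 'n"
  proof -
    let ?Is = "{is. set is \<subseteq> {1..d - 1} \<and> length is = m}"
    have y: "?y z i \<in> carrier_vec CARD('n)" if "i \<in> {1..d - 1}" for i
      using T[OF that] by (rule mult_mat_vec_carrier) (intro kron_power_carrier coord_vec_carrier)
    have "kron_fold (?y z) is \<in> carrier_vec (CARD('n) ^ m)" if "is \<in> ?Is" for "is"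
      using that y by (auto intro!: kron_fold_carrier)
    then have fold: "dim_vec (kron_fold (?y z) is) = CARD('n) ^ m" if "is \<in> ?Is" for "is"
      by (rule carrier_vecD) (use that in blast)
    have power: "kron_power (coord_vec idx (?\<Phi> z)) m $\<^sub>v j = (\<Sum>is\<in>?Is. kron_fold (?y z) is $\<^sub>v j)"
      if "j < CARD('n) ^ m" for j
      by (rule kron_power_sum[OF coord_vec_carrier y _ coord_vec_poly_transformation[OF idx] that]) simp_all
    have "c m \<bullet>\<^sub>v kron_power (coord_vec idx (?\<Phi> z)) m =
        (\<Sum>j<CARD('n) ^ m. c m $\<^sub>v j * kron_power (coord_vec idx (?\<Phi> z)) m $\<^sub>v j)"
      by (rule scalar_prod_sum) simp
    also have "\<dots> = (\<Sum>j<CARD('n) ^ m. \<Sum>is\<in>?Is. c m $\<^sub>v j * kron_fold (?y z) is $\<^sub>v j)"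
      by (intro sum.cong refl) (simp only: power lessThan_iff sum_distrib_left)
    also have "\<dots> = (\<Sum>is\<in>?Is. c m \<bullet>\<^sub>v kron_fold (?y z) is)"
      by (subst sum.swap) (simp add: scalar_prod_sum[OF fold])
    also have "\<dots> = (\<Sum>l=2..d. \<Sum>is\<in>compositions m l. c m \<bullet>\<^sub>v kron_fold (?y z) is) +
        (\<Sum>is\<in>?A m. c m \<bullet>\<^sub>v kron_fold (?y z) is)"
      using m by (intro sum_lists_split_degree) simp
    finally show ?thesis .
  qed
  \<comment> \<open>After exchanging the sums, \<open>m\<close> may be restricted to
    \<open>2..l\<close>, since there are no compositions of \<open>l\<close> into more than
    \<open>l\<close> parts.\<close>
  have collect: "(\<Sum>m=2..d. \<Sum>l=2..d. \<Sum>is\<in>compositions m l. c m \<bullet>\<^sub>v kron_fold (?y z) is) =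
      (\<Sum>l=2..d. pullback_part T c l (coord_vec idx z))" for z :: "real ^ 'n"
    unfolding pullback_part_def
    by (subst sum.swap, intro sum.cong[OF refl] sum.mono_neutral_right) (auto simp: compositions_empty)
  have "(\<Sum>m=2..d. c m \<bullet>\<^sub>v kron_power (coord_vec idx (?\<Phi> z)) m) =
      (\<Sum>l=2..d. pullback_part T c l (coord_vec idx z)) +
      (\<Sum>m=2..d. \<Sum>is\<in>?A m. c m \<bullet>\<^sub>v kron_fold (?y z) is)" for z
    by (subst collect[symmetric], subst sum.distrib[symmetric]) (rule sum.cong[OF refl expand])
  then have "(\<lambda>z. E (?\<Phi> z) - 1 / 2 * (\<Sum>l=2..d. pullback_part T c l (coord_vec idx z))) =
      (\<lambda>z. ?r (?\<Phi> z) + 1 / 2 * (\<Sum>m=2..d. \<Sum>is\<in>?A m. c m \<bullet>\<^sub>v kron_fold (?y z) is))"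
    by (simp add: fun_eq_iff algebra_simps)
  moreover have "\<dots> \<in> O[at 0](\<lambda>z. norm z ^ (d + 1))"
    using tail by (intro sum_in_bigo(1)[OF remainder] landau_o.big.cmult_in_iff[THEN iffD2]) simp_all
  ultimately show ?thesis by simp
qed

section \<open>The transformed energy functions\<close>

text \<open>\<open>mat_inverse\<close> returns an option. Invertibility makes \<open>R\<close> a
  unit of the matrix ring, which excludes the value \<open>None\<close>.\<close>

lemma the_mat_inverse:
  fixes R :: "real mat"
  assumes R: "R \<in> carrier_mat n n" "invertible_mat R"
  shows "the (mat_inverse R) \<in> carrier_mat n n" "the (mat_inverse R) * R = 1\<^sub>m n"
proof -
  obtain B where B: "inverts_mat R B" "inverts_mat B R"
    using R by (auto simp: invertible_mat_def)
  have RB: "R * B = 1\<^sub>m n" "B * R = 1\<^sub>m (dim_row B)" using B R by (auto simp: inverts_mat_def)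
  have "dim_col B = n" using arg_cong[OF RB(1), of dim_col] by simp
  moreover have "dim_row B = n" using arg_cong[OF RB(2), of dim_col] R by simp
  ultimately have BC: "B \<in> carrier_mat n n" by auto
  then have "R \<in> Units (ring_mat TYPE(real) n ())"
    using RB R BC by (auto simp: Units_def ring_mat_def intro!: bexI[of _ B])
  then obtain C where "mat_inverse R = Some C"
    using mat_inverse(1)[OF R(1), of "()"] by (cases "mat_inverse R") auto
  then show "the (mat_inverse R) \<in> carrier_mat n n" "the (mat_inverse R) * R = 1\<^sub>m n"
    using mat_inverse(2)[OF R(1)] by auto
qed

lemma scalar_prod_orthogonal_columns:
  fixes Q :: "real mat"
  assumes Q: "Q \<in> carrier_mat n n" "transpose_mat Q * Q = 1\<^sub>m n" and x: "x \<in> carrier_vec n"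
  shows "(Q *\<^sub>v x) \<bullet>\<^sub>v (Q *\<^sub>v x) = x \<bullet>\<^sub>v x"
proof -
  have "(Q *\<^sub>v x) \<bullet>\<^sub>v (1\<^sub>m n *\<^sub>v (Q *\<^sub>v x)) = x \<bullet>\<^sub>v ((transpose_mat Q * 1\<^sub>m n * Q) *\<^sub>v x)"
    by (rule scalar_prod_mult_mat_vec_mult_mat_vec[OF Q(1) _ Q(1) x x]) simp
  then show ?thesis using Q x by simp
qed

text \<open>Degree 2 admits only the composition \<open>[1, 1]\<close>, so the part is the quadratic
  form of \<open>A * transpose_mat A\<close> at \<open>T 1 *\<^sub>v z\<close>, a squared norm. It
  is applied with \<open>A\<close> equal to \<open>R\<close> and to \<open>L\<close>.\<close>

lemma pullback_part_2_square_root: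
  fixes A B :: "real mat"
  assumes A: "A \<in> carrier_mat n n" and T1: "T 1 \<in> carrier_mat n n" and z: "z \<in> carrier_vec n"
    and c2: "c 2 = vectorize (A * transpose_mat A)" and B: "transpose_mat A * T 1 = B"
  shows "pullback_part T c 2 z = (B *\<^sub>v z) \<bullet>\<^sub>v (B *\<^sub>v z)"
proof -
  have T: "T i \<in> carrier_mat n (n ^ i)" if "0 < i" "i < 2" for i
    using that T1 by (cases "i = 1") auto
  have At: "transpose_mat A \<in> carrier_mat n n" and AA: "A * transpose_mat A \<in> carrier_mat n n"
    and Tz: "T 1 *\<^sub>v z \<in> carrier_vec n" and BC: "B \<in> carrier_mat n n"
    using A T1 z B by auto
  have "{1..<2::nat} = {1}" by auto
  then have "pullback_part T c 2 z = (T 1 *\<^sub>v z) \<bullet>\<^sub>v ((A * transpose_mat A) *\<^sub>v (T 1 *\<^sub>v z))"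
    using pullback_part_bilinear[of 2 T n "A * transpose_mat A" z] T AA z
    by (simp add: pullback_part_def c2 kron_vec_one_right)
  also have "\<dots> = (transpose_mat A *\<^sub>v (T 1 *\<^sub>v z)) \<bullet>\<^sub>v (transpose_mat A *\<^sub>v (T 1 *\<^sub>v z))"
    using scalar_prod_mult_mat_vec_mult_mat_vec[OF At one_carrier_mat At Tz Tz] A At Tz by simp
  also have "transpose_mat A *\<^sub>v (T 1 *\<^sub>v z) = B *\<^sub>v z"
    using assoc_mult_mat_vec[OF At T1 z] B by simp
  finally show ?thesis .
qed

text \<open>Brings the input-normal and output-diagonal equations into the homogeneous form in which
  the lemmas on \<open>N_mat\<close> and \<open>N_hat_mat\<close> use them.\<close>

lemma mult_mat_vec_double_add_eq_zero:
  fixes N :: "real mat"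
  assumes N: "N \<in> carrier_mat r m" and X: "X \<in> carrier_vec m" and Y: "Y \<in> carrier_vec m"
    and eq: "2 \<cdot>\<^sub>v (N *\<^sub>v X) = - (N *\<^sub>v Y)"
  shows "N *\<^sub>v (2 \<cdot>\<^sub>v X + Y) = 0\<^sub>v r"
proof -
  have "N *\<^sub>v (2 \<cdot>\<^sub>v X + Y) = 2 \<cdot>\<^sub>v (N *\<^sub>v X) + N *\<^sub>v Y"
    using N X Y by (simp add: mult_add_distrib_mat_vec[OF N] mult_mat_vec[OF N X])
  also have "\<dots> = 0\<^sub>v r" unfolding eq using N Y by auto
  finally show ?thesis .
qed

theorem theorem2:
  fixes f :: "real ^ 'n \<Rightarrow> real ^ 'n"
    and g :: "real ^ 'n \<Rightarrow> real ^ 'm ^ 'n"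
    and h :: "real ^ 'n \<Rightarrow> real ^ 'p"
    and Ec Eo :: "real ^ 'n \<Rightarrow> real"
    and n d :: nat
    and idx :: "'n \<Rightarrow> nat"
    and v w :: "nat \<Rightarrow> real Matrix.vec"
    and V2 W2 R L U S V :: "real mat"
    and ms :: "nat \<Rightarrow> nat list list"
    and T :: "nat \<Rightarrow> real mat"
  assumes n: "n = CARD('n)"
    and idx: "bij_betw idx UNIV {..<n}"
    and f_analytic: "\<And>i. real_analytic (\<lambda>x. f x $ i)"
    and g_analytic: "\<And>i j. real_analytic (\<lambda>x. g x $ i $ j)"
    and h_analytic: "\<And>i. real_analytic (\<lambda>x. h x $ i)"
    and f0: "f 0 = 0"
    and h0: "h 0 = 0"
    and lin_minimal:
      "minimal (jacobian f (at 0)) (g 0) (jacobian h (at 0))"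
    and lin_stable: "asymptotically_stable (\<lambda>x. jacobian f (at 0) *v x)"
    and Ec_energy: "controllability_energy f g Ec"
    and Eo_energy: "observability_energy f h Eo"
    and Ec_smooth: "smooth Ec"
    and Eo_smooth: "smooth Eo"
    and closed_loop_stable:
      "asymptotically_stable (\<lambda>x. - (f x + (g x ** transpose (g x)) *v grad Ec x))"
    and Ec_HJ: "\<And>x. 0 = grad Ec x \<bullet> f x
                      + 1 / 2 * (grad Ec x \<bullet> ((g x ** transpose (g x)) *v grad Ec x))"
    and Ec_0: "Ec 0 = 0"
    and Eo_HJ: "\<And>x. 0 = grad Eo x \<bullet> f x + 1 / 2 * (h x \<bullet> h x)"
    and Eo_0: "Eo 0 = 0"
    and d: "2 \<le> d"
    and v_dim: "\<And>i. i \<in> {2..d} \<Longrightarrow> v i \<in> carrier_vec (n ^ i)"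
    and w_dim: "\<And>i. i \<in> {2..d} \<Longrightarrow> w i \<in> carrier_vec (n ^ i)"
    and Ec_coeffs: "(\<lambda>x. Ec x - 1 / 2 * (\<Sum>i=2..d. v i \<bullet>\<^sub>v kron_power (coord_vec idx x) i))
                      \<in> O[at 0](\<lambda>x. norm x ^ (d + 1))"
    and Eo_coeffs: "(\<lambda>x. Eo x - 1 / 2 * (\<Sum>i=2..d. w i \<bullet>\<^sub>v kron_power (coord_vec idx x) i))
                      \<in> O[at 0](\<lambda>x. norm x ^ (d + 1))"
    and V2: "V2 \<in> carrier_mat n n" "transpose_mat V2 = V2" "v 2 = vectorize V2"
    and W2: "W2 \<in> carrier_mat n n" "transpose_mat W2 = W2" "w 2 = vectorize W2"
    and R: "R \<in> carrier_mat n n" "invertible_mat R" "V2 = R * transpose_mat R"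
    and L: "L \<in> carrier_mat n n" "invertible_mat L" "W2 = L * transpose_mat L"
    and svd: "is_svd n (transpose_mat L * transpose_mat (the (mat_inverse R))) U S V"
    and ms: "\<And>k. k \<in> {3..d} \<Longrightarrow> monomial_order n k (ms k)"
    and T_1: "T 1 = transpose_mat (the (mat_inverse R)) * V"
    and T_dim: "\<And>k. k \<in> {3..d} \<Longrightarrow> T (k - 1) \<in> carrier_mat n (n ^ (k - 1))"
    and input_normal_eqs: "\<And>k. k \<in> {3..d} \<Longrightarrow>
      2 \<cdot>\<^sub>v (N_mat n k (ms k) *\<^sub>v
        ((1\<^sub>m (n ^ (k - 1)) \<otimes>\<^sub>K (transpose_mat (T 1) * V2)) *\<^sub>v vectorize (T (k - 1))))
      = - (N_mat n k (ms k) *\<^sub>v lower_terms n T V2 v k)"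
    and output_diagonal_eqs: "\<And>k. k \<in> {3..d} \<Longrightarrow>
      2 \<cdot>\<^sub>v (N_hat_mat n k (ms k) *\<^sub>v
        ((1\<^sub>m (n ^ (k - 1)) \<otimes>\<^sub>K (transpose_mat (T 1) * W2)) *\<^sub>v vectorize (T (k - 1))))
      = - (N_hat_mat n k (ms k) *\<^sub>v lower_terms n T W2 w k)"
  shows "input_normal_output_diagonal d Ec Eo (poly_transformation idx (d - 1) T)"
proof -
  let ?Ri = "the (mat_inverse R)" and ?\<Phi> = "poly_transformation idx (d - 1) T"
  have idx': "bij_betw idx UNIV {..<CARD('n)}" using idx n by simp
  have Ri: "?Ri \<in> carrier_mat n n" "?Ri * R = 1\<^sub>m n" using the_mat_inverse[OF R(1,2)] by auto
  have U: "U \<in> carrier_mat n n" "transpose_mat U * U = 1\<^sub>m n"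
    and V: "V \<in> carrier_mat n n" "transpose_mat V * V = 1\<^sub>m n"
    and S: "S \<in> carrier_mat n n" "diagonal_mat S"
    and LR: "transpose_mat L * transpose_mat ?Ri = U * S * transpose_mat V"
    using svd by (auto simp: is_svd_def)
  have T1: "T 1 \<in> carrier_mat n n" unfolding T_1 using Ri V by auto
  have T: "T i \<in> carrier_mat n (n ^ i)" if "i \<in> {1..d - 1}" for i
    using T_dim[of "i + 1"] T1 that by (cases "i = 1") auto
  \<comment> \<open>The inverse transpose in \<open>T 1\<close> cancels against the transpose of
    \<open>R\<close>.\<close>
  have RT1: "transpose_mat R * T 1 = V"
  proof -
    have "transpose_mat R * T 1 = transpose_mat (?Ri * R) * V"
      unfolding T_1 transpose_mult[OF Ri(1) R(1)] using Ri R V by (simp add: assoc_mult_mat[of _ n n _ n _ n])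
    then show ?thesis using Ri V by simp
  qed
  \<comment> \<open>Here the singular value decomposition enters; its right factor cancels against
    \<open>V\<close>.\<close>
  have LT1: "transpose_mat L * T 1 = U * S"
  proof -
    have "transpose_mat L * T 1 = (transpose_mat L * transpose_mat ?Ri) * V"
      unfolding T_1 using Ri L V by (simp add: assoc_mult_mat[of _ n n _ n _ n])
    also have "\<dots> = (U * S) * (transpose_mat V * V)"
      unfolding LR using U S V by (simp add: assoc_mult_mat[of _ n n _ n _ n])
    finally show ?thesis using U S V by simp
  qed
  \<comment> \<open>The vector q of the proof idea. \<open>M\<close>, \<open>c\<close> and the
    multiplying matrix \<open>N\<close> stay arbitrary, so that the next fact serves both energy
    functions, with \<open>N_mat\<close> and with \<open>N_hat_mat\<close>.\<close>
  define coeff where "coeff M c l = 2 \<cdot>\<^sub>v ((1\<^sub>m (n ^ (l - 1)) \<otimes>\<^sub>K (transpose_mat (T 1) * M)) *\<^sub>v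
    vectorize (T (l - 1))) + lower_terms n T M c l" for M c l
  have coeff: "coeff M c l \<in> carrier_vec (n ^ l) \<and>
      (\<forall>z \<in> carrier_vec n. pullback_part T c l z = coeff M c l \<bullet>\<^sub>v kron_power z l) \<and>
      (\<forall>r N. N \<in> carrier_mat r (n ^ l) \<longrightarrow>
        2 \<cdot>\<^sub>v (N *\<^sub>v ((1\<^sub>m (n ^ (l - 1)) \<otimes>\<^sub>K (transpose_mat (T 1) * M)) *\<^sub>v vectorize (T (l - 1)))) =
          - (N *\<^sub>v lower_terms n T M c l) \<longrightarrow>
        N *\<^sub>v coeff M c l = 0\<^sub>v r)"
    if M: "M \<in> carrier_mat n n" "transpose_mat M = M" and c: "\<And>m. m \<in> {2..d} \<Longrightarrow> c m \<in> carrier_vec (n ^ m)"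
      and c2: "c 2 = vectorize M" and l: "l \<in> {3..d}" for M c l
  proof -
    have Tl: "T i \<in> carrier_mat n (n ^ i)" if "0 < i" "i < l" for i using that l by (intro T) auto
    have cl: "c m \<in> carrier_vec (n ^ m)" if "m \<in> {3..l}" for m using that l by (intro c) auto
    have X: "(1\<^sub>m (n ^ (l - 1)) \<otimes>\<^sub>K (transpose_mat (T 1) * M)) *\<^sub>v vectorize (T (l - 1)) \<in> carrier_vec (n ^ l)"
      using leading_term_carrier[OF Tl M(1)] l by simp
    have Y: "lower_terms n T M c l \<in> carrier_vec (n ^ l)" using lower_terms_carrier(3)[OF Tl M(1) cl] .
    show ?thesis
      unfolding coeff_def
      using pullback_part_eq[OF Tl M cl c2] mult_mat_vec_double_add_eq_zero[OF _ X Y] l X Y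
      by (auto intro!: add_carrier_vec smult_carrier_vec)
  qed
  have N: "N_mat n k (ms k) \<in> carrier_mat (length (ms k)) (n ^ k)"
    and N_hat: "N_hat_mat n k (ms k) \<in> carrier_mat (length (ms k) - n) (n ^ k)" for k
    by (auto simp: N_mat_def N_hat_mat_def)
  have split: "{2..d} = insert 2 {3..d}" using d by auto
  have coord: "coord_vec idx z \<in> carrier_vec n" for z unfolding n by (rule coord_vec_carrier)
  have sum_coord: "(\<Sum>a<n. \<phi> a (coord_vec idx z $\<^sub>v a)) = (\<Sum>i\<in>UNIV. \<phi> (idx i) (z $ i))"
    for \<phi> :: "nat \<Rightarrow> real \<Rightarrow> real" and z
    by (subst sum.reindex_bij_betw[OF idx, symmetric]) (simp add: coord_vec_index[OF idx'])

  \<comment> \<open>The controllability energy: orthogonality of \<open>V\<close> settles degree 2,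
    and the input-normal equations annihilate the degrees 3 to \<open>d\<close>.\<close>
  have "pullback_part T v 2 z = z \<bullet>\<^sub>v z" if z: "z \<in> carrier_vec n" for z
    using pullback_part_2_square_root[where T = T and c = v, OF R(1) T1 z _ RT1] scalar_prod_orthogonal_columns[OF V z] V2 R by simp
  moreover have "pullback_part T v l z = 0" if l: "l \<in> {3..d}" and z: "z \<in> carrier_vec n" for l z
    using coeff[OF V2(1,2) v_dim V2(3) l] N input_normal_eqs[OF l] N_mat_zero_imp_zero[OF ms[OF l] _ _ z] z
    by metis
  ultimately have "(\<Sum>l=2..d. pullback_part T v l (coord_vec idx z)) = (\<Sum>i\<in>UNIV. (z $ i)\<^sup>2)" for z
    using sum_coord[of "\<lambda>_ t. t\<^sup>2" z] coord[of z]
    by (simp add: split scalar_prod_sum[of _ n] power2_eq_square)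
  moreover have "(\<lambda>z. Ec (?\<Phi> z) - 1 / 2 * (\<Sum>l=2..d. pullback_part T v l (coord_vec idx z)))
      \<in> O[at 0](\<lambda>z. norm z ^ (d + 1))"
    using energy_pullback_expansion[OF idx' _ _ Ec_coeffs Ec_0] T v_dim n by simp
  ultimately have input_normal: "(\<lambda>z. Ec (?\<Phi> z) - 1 / 2 * (\<Sum>i\<in>UNIV. (z $ i)\<^sup>2))
      \<in> O[at 0](\<lambda>z. norm z ^ (d + 1))" by simp

  \<comment> \<open>The observability energy: in degree 2 the orthogonal \<open>U\<close> drops out
    and the squared singular values remain. In higher degrees the output-diagonal equations leave
    pure powers.\<close>
  have "pullback_part T w 2 z = (\<Sum>a<n. (S $$ (a, a))\<^sup>2 * (z $\<^sub>v a) ^ 2)" if z: "z \<in> carrier_vec n" for z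
  proof -
    have Sz: "(S *\<^sub>v z) $\<^sub>v a = S $$ (a, a) * z $\<^sub>v a" if a: "a < n" for a
    proof -
      have "(S *\<^sub>v z) $\<^sub>v a = (\<Sum>b<n. S $$ (a, b) * z $\<^sub>v b)"
        using S z a by (intro mult_mat_vec_index) auto
      also have "\<dots> = (\<Sum>b<n. if b = a then S $$ (a, a) * z $\<^sub>v a else 0)"
        using S a by (intro sum.cong refl) (auto simp: diagonal_mat_def)
      finally show ?thesis using a by simp
    qed
    have SzC: "S *\<^sub>v z \<in> carrier_vec n" using S z by auto
    have "pullback_part T w 2 z = (U *\<^sub>v (S *\<^sub>v z)) \<bullet>\<^sub>v (U *\<^sub>v (S *\<^sub>v z))"
      using pullback_part_2_square_root[where T = T and c = w, OF L(1) T1 z _ LT1] W2 L assoc_mult_mat_vec[OF U(1) S(1) z] by simp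
    also have "\<dots> = (S *\<^sub>v z) \<bullet>\<^sub>v (S *\<^sub>v z)" by (rule scalar_prod_orthogonal_columns[OF U SzC])
    also have "\<dots> = (\<Sum>a<n. (S $$ (a, a))\<^sup>2 * (z $\<^sub>v a) ^ 2)"
      unfolding scalar_prod_sum[OF carrier_vecD[OF SzC]]
      by (intro sum.cong refl) (simp add: Sz power2_eq_square mult_ac del: index_mult_mat_vec)
    finally show ?thesis .
  qed
  moreover have "\<exists>b. \<forall>z \<in> carrier_vec n. pullback_part T w l z = (\<Sum>a<n. b a * (z $\<^sub>v a) ^ l)"
    if l: "l \<in> {3..d}" for l
    using coeff[OF W2(1,2) w_dim W2(3) l] N_hat output_diagonal_eqs[OF l]
      N_hat_mat_zero_imp_univariate[OF ms[OF l], of "coeff W2 w l"]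
    by metis
  ultimately have "\<exists>b. \<forall>z \<in> carrier_vec n. pullback_part T w l z = (\<Sum>a<n. b a * (z $\<^sub>v a) ^ l)"
    if "l \<in> {2..d}" for l
    using that unfolding split by (cases "l = 2") auto
  then obtain b where b: "pullback_part T w l z = (\<Sum>a<n. b l a * (z $\<^sub>v a) ^ l)"
    if "l \<in> {2..d}" "z \<in> carrier_vec n" for l z
    by metis
  \<comment> \<open>The degree is lowered by 2 because the factor \<open>(z $ i)\<^sup>2\<close>
    stands outside; all degrees are at least 2, so the subtraction is exact.\<close>
  define \<sigma>2 where "\<sigma>2 i = (\<Sum>l=2..d. monom (b l (idx i)) (l - 2))" for i
  have "(\<Sum>l=2..d. pullback_part T w l (coord_vec idx z)) = (\<Sum>i\<in>UNIV. (z $ i)\<^sup>2 * poly (\<sigma>2 i) (z $ i))" for z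
  proof -
    have "(\<Sum>l=2..d. pullback_part T w l (coord_vec idx z)) =
        (\<Sum>l=2..d. \<Sum>i\<in>UNIV. b l (idx i) * (z $ i) ^ l)"
      using sum_coord[of "\<lambda>a t. b _ a * t ^ _" z] by (intro sum.cong refl) (simp add: b coord)
    also have "\<dots> = (\<Sum>i\<in>UNIV. \<Sum>l=2..d. (z $ i)\<^sup>2 * (b l (idx i) * (z $ i) ^ (l - 2)))"
    proof (subst sum.swap, intro sum.cong refl)
      fix i l assume "l \<in> {2..d}"
      then have "2 + (l - 2) = l" by auto
      then have "(z $ i) ^ l = (z $ i)\<^sup>2 * (z $ i) ^ (l - 2)" by (metis power_add)
      then show "b l (idx i) * (z $ i) ^ l = (z $ i)\<^sup>2 * (b l (idx i) * (z $ i) ^ (l - 2))" by simp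
    qed
    finally show ?thesis by (simp add: \<sigma>2_def poly_sum poly_monom sum_distrib_left)
  qed
  moreover have "(\<lambda>z. Eo (?\<Phi> z) - 1 / 2 * (\<Sum>l=2..d. pullback_part T w l (coord_vec idx z)))
      \<in> O[at 0](\<lambda>z. norm z ^ (d + 1))"
    using energy_pullback_expansion[OF idx' _ _ Eo_coeffs Eo_0] T w_dim n by simp
  ultimately have "(\<lambda>z. Eo (?\<Phi> z) - 1 / 2 * (\<Sum>i\<in>UNIV. (z $ i)\<^sup>2 * poly (\<sigma>2 i) (z $ i)))
      \<in> O[at 0](\<lambda>z. norm z ^ (d + 1))" by simp
  with input_normal show ?thesis unfolding input_normal_output_diagonal_def by blast
qed

end
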